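(* Let $a$, $b$, $c$, $d$, $e$, and $u$ be indeterminates. Then $$\sum_{n=-\infty}^{\infty}\frac{(1-aq^{2n})}{(1-a)}\frac{(b,c;q)_n}{(aq/b,aq/c;q)_n}\frac{(dq,eq;q)_n}{(aq/d,aq/e;q)_n}\left(\frac{a^2}{bcde}\right)^n\left(1-\frac{(1-de/a)(1-uq^n)(1-a^2q^n/bcu)}{(1-a/bc)(1-dq^n)(1-eq^n)}\right)$$ $$=\frac{(1-a/cu)(1-bu/a)\,(q,aq,q/a,aq/bc,aq/bd,aq/be,aq/cd,aq/ce,a/de;q)_{\infty}}{(b-a/c)\,(q/b,aq/b,q/c,aq/c,1/d,aq/d,1/e,aq/e,a^2q/bcde;q)_{\infty}},$$ provided $|a^2/bcde|<1$.
   Context: Here $q$ is a fixed complex number with $0<|q|<1$. Notation: $(x;q)_\infty=\prod_{j\ge 0}(1-xq^j)$; for every integer $k$, $(x;q)_k=(x;q)_\infty/(xq^k;q)_\infty$, i.e. $(x;q)_k=\prod_{j=0}^{k-1}(1-xq^j)$ for $k\ge0$ and $(x;q)_{k}=\prod_{j=1}^{-k}(1-xq^{-j})^{-1}$ for $k<0$; and $(x_1,\dots,x_m;q)_k=(x_1;q)_k\cdots(x_m;q)_k$ for $k$ an integer or $\infty$. In a parameter such as $aq/bc$ everything after the slash is in the denominator, i.e. $aq/bc=aq/(bc)$, $a^2q^n/bcu=a^2q^n/(bcu)$. The indeterminates are understood as nonzero complex numbers in general position (no denominator occurring in the statement vanishes). *)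

theory Defs
  imports "HOL-Analysis.Analysis"
begin

definition qpoch_inf :: "complex \<Rightarrow> complex \<Rightarrow> complex" where
  "qpoch_inf q x = (\<Prod>j. 1 - x * q ^ j)"

text \<open>
  The finite products are used for \<open>(x;q)\<^sub>k\<close> because the quotient
  \<open>(x;q)\<^sub>\<infinity> / (xq\<^sup>k;q)\<^sub>\<infinity>\<close> reads \<open>0/0\<close> when \<open>k \<ge> 0\<close> and
  \<open>xq\<^sup>k\<close> is a nonpositive power of \<open>q\<close>, although \<open>(x;q)\<^sub>k\<close> is perfectly well defined there.
\<close>

definition qpoch :: "complex \<Rightarrow> complex \<Rightarrow> int \<Rightarrow> complex" where
  "qpoch q x k =
     (if k \<ge> 0 then \<Prod>j<nat k. 1 - x * q ^ j
      else \<Prod>j=1..nat (- k). inverse (1 - x * q powi (- int j)))"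

text \<open>\<open>(x\<^sub>1, \<dots>, x\<^sub>m; q)\<^sub>k\<close> for an integer \<open>k\<close> and for \<open>k = \<infinity>\<close>.\<close>

definition qpochs :: "complex \<Rightarrow> complex list \<Rightarrow> int \<Rightarrow> complex" where
  "qpochs q xs k = (\<Prod>x\<leftarrow>xs. qpoch q x k)"

definition qpochs_inf :: "complex \<Rightarrow> complex list \<Rightarrow> complex" where
  "qpochs_inf q xs = (\<Prod>x\<leftarrow>xs. qpoch_inf q x)"

end

theory Submission
  imports Defs
begin

text \<open>
  Put \<open>x = q\<^sup>n\<close> and write the summand, up to a constant factor, as
  \<open>(1 - a x\<^sup>2) a\<^sup>2\<^sup>n P\<^sub>n\<close> times a polynomial in \<open>x\<close>, where \<open>P\<^sub>n\<close> is the product of the four factors \<open>(y;q)\<^sub>n / ((aq/y;q)\<^sub>n y\<^sup>n)\<close> for \<open>y = b, c, d, e\<close>.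
  The coefficient \<open>(1 - de/a)/(1 - a/bc)\<close> in the statement is exactly the one that makes this
  polynomial quasi-palindromic, that is, of the form \<open>\<alpha> (1 + a x\<^sup>2) + \<beta> x\<close>.

  For such polynomials there is one linear relation. The difference \<open>T\<^sub>n - T\<^sub>n\<^sub>-\<^sub>1\<close> of
  \<open>T\<^sub>n = a\<^sup>2\<^sup>n P\<^sub>n (1 - bx)(1 - cx)(1 - dx)(1 - ex)\<close> is \<open>a\<^sup>2\<^sup>n P\<^sub>n\<close> times a quartic in \<open>x\<close> that factors as
  \<open>(1 - a x\<^sup>2)(A (1 + a x\<^sup>2) + B x)\<close>, and the bilateral sum of a difference vanishes. Hence
  every sum of this kind is an explicit multiple of the sum \<open>\<psi>(b,c,d,e)\<close> whose polynomial is \<open>x\<close>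
  (lemma \<open>palindromic_has_sum\<close>), which is Bailey's very well-poised \<open>\<^sub>6\<psi>\<^sub>6\<close> series up to the
  factor \<open>1 - a\<close>. The multiple is computed in \<open>reduction_constant\<close>; the theorem becomes Bailey's
  summation formula.

  Bailey's formula comes from the same relation. Replacing \<open>e\<close> by \<open>eq\<close> multiplies the summand of
  \<open>\<psi>\<close> by the quasi-palindromic factor \<open>(1 - ex)(e - ax)/x\<close>, up to a constant, so \<open>\<psi>(b,c,d,eq)\<close> is
  a multiple of \<open>\<psi>(b,c,d,e)\<close>, and the multiple is the one that the product side satisfies
  (\<open>psi_contiguous\<close>). Iterating in all four parameters moves them to infinity, where the product side
  tends to 1 and \<open>\<psi>\<close> tends, by dominated convergence (\<open>psi_tendsto\<close>), to a theta series in which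
  \<open>a\<close> is the only parameter left. So \<open>\<psi>\<close> is the product times a function of \<open>a\<close>. That function is found by choosing
  \<open>d = 1\<close> and \<open>e = a\<close>, where only the term \<open>n = 0\<close> of \<open>\<psi>\<close> survives (\<open>infsum_theta_term\<close>); this
  proves the product expansion of the theta series as well.
\<close>

section \<open>Bilateral series\<close>

text \<open>The recurrence form of the ratio test allows terms to vanish, as they do for special parameters.\<close>
lemma ratio_test_tendsto:
  fixes f h :: "nat \<Rightarrow> 'a :: real_normed_field"
  assumes rec: "eventually (\<lambda>n. f (Suc n) = h n * f n) sequentially"
    and h: "h \<longlonglongrightarrow> l" and l: "norm l < 1"
  shows "summable (\<lambda>n. norm (f n))"
proof -
  obtain r where r: "norm l < r" "r < 1" using l dense by blast
  have "eventually (\<lambda>n. norm (h n) < r) sequentially"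
    using tendsto_norm[OF h] r(1) by (rule order_tendstoD)
  with rec have "eventually (\<lambda>n. norm (f (Suc n)) \<le> r * norm (f n)) sequentially"
    by eventually_elim (simp add: norm_mult mult_right_mono)
  then obtain N where "\<And>n. n \<ge> N \<Longrightarrow> norm (f (Suc n)) \<le> r * norm (f n)"
    by (auto simp: eventually_at_top_linorder)
  then show ?thesis
    by (intro summable_ratio_test[OF r(2), of N]) auto
qed

lemma has_sum_int_halves:
  fixes f :: "int \<Rightarrow> 'a :: banach"
  assumes "summable (\<lambda>n. norm (f (int n)))" "summable (\<lambda>n. norm (f (- int (Suc n))))"
  shows "(f has_sum ((\<Sum>n. f (int n)) + (\<Sum>n. f (- int (Suc n))))) UNIV"
proof -
  have 1: "(f has_sum (\<Sum>n. f (int n))) {0..}"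
  proof -
    have "((\<lambda>n. f (int n)) has_sum (\<Sum>n. f (int n))) UNIV"
      using assms(1) by (intro norm_summable_imp_has_sum) (auto intro: summable_norm_cancel)
    moreover have "bij_betw int UNIV {0..}"
      by (rule bij_betw_byWitness[where f' = nat]) auto
    ultimately show ?thesis using has_sum_reindex_bij_betw by blast
  qed
  have 2: "(f has_sum (\<Sum>n. f (- int (Suc n)))) {..<0}"
  proof -
    have "((\<lambda>n. f (- int (Suc n))) has_sum (\<Sum>n. f (- int (Suc n)))) UNIV"
      using assms(2) by (intro norm_summable_imp_has_sum) (auto intro: summable_norm_cancel)
    moreover have "bij_betw (\<lambda>n. - int (Suc n)) UNIV {..<0}"
      by (rule bij_betw_byWitness[where f' = "\<lambda>k. nat (- k - 1)"]) auto
    ultimately show ?thesis using has_sum_reindex_bij_betw by blast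
  qed
  have "{0..} \<union> {..<0} = (UNIV :: int set)" by auto
  moreover have "{0..} \<inter> {..<0} = ({} :: int set)" by auto
  ultimately show ?thesis using has_sum_Un_disjoint[OF 1 2] by simp
qed

text \<open>Tannery's theorem is applied separately to the nonnegative and to the negative indices.\<close>
lemma tannery_bilateral:
  fixes f :: "nat \<Rightarrow> int \<Rightarrow> complex"
  assumes lim: "\<And>n. (\<lambda>N. f N n) \<longlonglongrightarrow> g n"
    and bound: "eventually (\<lambda>N. \<forall>n. norm (f N (int n)) \<le> M n) sequentially"
      "eventually (\<lambda>N. \<forall>n. norm (f N (- int (Suc n))) \<le> M' n) sequentially"
    and M: "summable M" "summable M'"
  shows "(\<lambda>N. infsum (f N) UNIV) \<longlonglongrightarrow> infsum g UNIV"
proof -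
  have ev: "eventually (\<lambda>(k,N). norm (F k N) \<le> m k) (at_top \<times>\<^sub>F sequentially)"
    if "eventually (\<lambda>N. \<forall>n. norm (F n N) \<le> m n) sequentially" for F :: "nat \<Rightarrow> nat \<Rightarrow> complex" and m
    unfolding eventually_prod_filter using that
    by (intro exI[of _ "\<lambda>_. True"] exI[of _ "\<lambda>N. \<forall>n. norm (F n N) \<le> m n"]) auto
  note T1 = tannerys_theorem[where a = "\<lambda>k N. f N (int k)" and b = "\<lambda>k. g (int k)" and F = sequentially,
      OF lim ev[OF bound(1)] M(1) sequentially_bot]
  note T2 = tannerys_theorem[where a = "\<lambda>k N. f N (- int (Suc k))" and b = "\<lambda>k. g (- int (Suc k))" and F = sequentially,
      OF lim ev[OF bound(2)] M(2) sequentially_bot]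
  have g: "(g has_sum ((\<Sum>n. g (int n)) + (\<Sum>n. g (- int (Suc n))))) UNIV"
    using T1 T2 by (intro has_sum_int_halves) auto
  have "eventually (\<lambda>N. infsum (f N) UNIV = (\<Sum>n. f N (int n)) + (\<Sum>n. f N (- int (Suc n)))) sequentially"
    using T1[THEN conjunct1] T2[THEN conjunct1]
    by eventually_elim (intro infsumI has_sum_int_halves, auto)
  moreover have "(\<lambda>N. (\<Sum>n. f N (int n)) + (\<Sum>n. f N (- int (Suc n)))) \<longlonglongrightarrow> infsum g UNIV"
    using T1 T2 by (subst infsumI[OF g]) (intro tendsto_add, auto)
  ultimately show "(\<lambda>N. infsum (f N) UNIV) \<longlonglongrightarrow> infsum g UNIV"
    using tendsto_cong by fastforce
qed

text \<open>
  A first-order recurrence \<open>f (n + 1) v\<^sub>n = f n w\<^sub>n\<close> determines \<open>f\<close> from \<open>f 0\<close> if it can be solved forwards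
  on the right half-line and backwards on the left one. Identities between shifted factorials of
  integer index are proved by this principle, which avoids treating the two signs of \<open>n\<close> apart.
\<close>
lemma two_sided_recurrence_unique:
  fixes f g v w :: "int \<Rightarrow> 'a :: field"
  assumes f: "\<And>n. f (n + 1) * v n = f n * w n" and g: "\<And>n. g (n + 1) * v n = g n * w n"
    and v: "\<And>n. n \<ge> 0 \<Longrightarrow> v n \<noteq> 0" and w: "\<And>n. n < 0 \<Longrightarrow> w n \<noteq> 0" and 0: "f 0 = g 0"
  shows "f n = g n"
proof (induction n rule: int_induct[of _ 0])
  case base show ?case by (rule 0)
next
  case (step1 i)
  then show ?case using f[of i] g[of i] v[of i] by (metis mult_right_cancel)
next
  case (step2 i)
  then show ?case using f[of "i - 1"] g[of "i - 1"] w[of "i - 1"] by simp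
qed

section \<open>Elementary identities\<close>

lemma triangular_step: "(n + 1) * n div 2 = n * (n - 1) div 2 + (n :: int)"
proof -
  have "(n + 1) * n = n * (n - 1) + n * 2" by (simp add: algebra_simps)
  then show ?thesis by simp
qed

text \<open>
  For \<open>\<alpha> = 1 - X\<close> and \<open>\<beta> = X (u + a\<^sup>2/bcu) - (d + e)\<close> this is the factor \<open>\<beta> - \<alpha> B/A\<close> by which the
  quasi-palindromic sum differs from \<open>\<psi>\<close>. The dependence on \<open>u\<close> enters only through \<open>u + a\<^sup>2/bcu\<close>.
  The expression vanishes when that equals \<open>a/b + a/c\<close>, that is, at \<open>u = a/c\<close> and \<open>u = a/b\<close>,
  which explains the two factors containing \<open>u\<close> on the right.
\<close>
lemma reduction_constant:
  fixes a b c d e u :: "'a :: field"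
  assumes nz: "a \<noteq> 0" "b \<noteq> 0" "c \<noteq> 0" "d \<noteq> 0" "e \<noteq> 0" "u \<noteq> 0"
    and bc: "b * c \<noteq> a" and A: "b * c * d * e \<noteq> a^2"
  defines "X \<equiv> (1 - d * e / a) / (1 - a / (b * c))"
  shows "(X * (u + a^2 / (b * c * u)) - (d + e))
      - (1 - X) * ((b * c * d + b * c * e + b * d * e + c * d * e) / a - (b + c + d + e)) / (1 - b * c * d * e / a^2)
    = (1 - a / (c * u)) * (1 - b * u / a) * (1 - a / (d * e)) * d * e / (b - a / c)"
proof -
  define w where "w = 1 - a / (b * c)"
  have "a / (b * c) \<noteq> 1" using nz not_sym[OF bc] by simp
  then have w: "w \<noteq> 0" unfolding w_def right_minus_eq by metis
  define A where "A = 1 - b * c * d * e / a^2"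
  have "b * c * d * e / a^2 \<noteq> 1" using nz A by simp
  then have A0: "A \<noteq> 0" unfolding A_def right_minus_eq by metis
  define B where "B = (b * c * d + b * c * e + b * d * e + c * d * e) / a - (b + c + d + e)"
  have X: "X = (1 - d * e / a) / w" by (simp add: X_def w_def)
  have "1 - X = (w - (1 - d * e / a)) / w" using w by (simp add: X diff_divide_distrib)
  also have "w - (1 - d * e / a) = - (a / (b * c)) * A"
    using nz by (simp add: w_def A_def field_simps power2_eq_square)
  finally have 1: "(1 - X) * B / A = - (a / (b * c)) * B / w" using A0 by simp
  have 2: "(1 - d * e / a) * (a / b + a / c) - (d + e) * w + a / (b * c) * B = 0"
    using nz by (simp add: w_def B_def divide_simps) (simp add: algebra_simps power2_eq_square)
  have 3: "(1 - a / (c * u)) * (1 - b * u / a) = - (b / a) * (u + a^2 / (b * c * u) - (a / b + a / c))"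
    using nz by (simp add: field_simps power2_eq_square)
  have 4: "(1 - a / (d * e)) * d * e = - a * (1 - d * e / a)" using nz by (simp add: field_simps)
  have 5: "b - a / c = b * w" using nz by (simp add: w_def field_simps)
  have "X * (u + a^2 / (b * c * u)) - (d + e) - (1 - X) * B / A
      = ((1 - d * e / a) * (u + a^2 / (b * c * u)) - (d + e) * w + a / (b * c) * B) / w"
    unfolding 1 unfolding X using w by (simp add: field_simps)
  also have "(1 - d * e / a) * (u + a^2 / (b * c * u)) - (d + e) * w + a / (b * c) * B
      = (1 - d * e / a) * (u + a^2 / (b * c * u) - (a / b + a / c))"
    using 2 by (simp add: algebra_simps)
  also have "(1 - d * e / a) * (u + a^2 / (b * c * u) - (a / b + a / c)) / w
      = (- (b / a) * (u + a^2 / (b * c * u) - (a / b + a / c))) * (- a * (1 - d * e / a)) / (b * w)"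
    using nz by simp
  finally show ?thesis unfolding 3[symmetric] 4[symmetric] 5[symmetric] A_def B_def by (simp add: mult_ac)
qed

section \<open>The shifted factorials\<close>

locale q_disc =
  fixes q :: complex
  assumes q0: "q \<noteq> 0" and q1: "norm q < 1"
begin

lemma q_power_lt_1: "k > 0 \<Longrightarrow> norm (q ^ k) < 1"
  using q1 by (simp add: norm_power power_less_one_iff)

lemma q_power_ne_1: "k > 0 \<Longrightarrow> q ^ k \<noteq> 1"
  using q_power_lt_1[of k] by auto

lemma powi_neg: "n < 0 \<Longrightarrow> q powi n = inverse (q ^ nat (- n))"
  by (simp add: power_int_def power_inverse)

lemma q_powi_Suc: "q powi (n + 1) = q powi n * q"
  using q0 by (simp add: power_int_add)

lemma convergent_qpoch_inf: "convergent_prod (\<lambda>j. 1 - x * q ^ j)"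
proof -
  have "summable (\<lambda>j. norm (- x * q ^ j))"
    using q1 by (simp add: norm_mult norm_power summable_geometric)
  then have "abs_convergent_prod (\<lambda>j. 1 + (- x * q ^ j))"
    by (intro summable_imp_abs_convergent_prod) simp
  then show ?thesis using abs_convergent_prod_imp_convergent_prod by fastforce
qed

lemma qpoch_inf_eq_0_iff: "qpoch_inf q x = 0 \<longleftrightarrow> (\<exists>j. x * q ^ j = 1)"
proof -
  have "(\<lambda>j. 1 - x * q ^ j) has_prod qpoch_inf q x"
    unfolding qpoch_inf_def by (rule convergent_prod_has_prod[OF convergent_qpoch_inf])
  then have "qpoch_inf q x = 0 \<longleftrightarrow> 0 \<in> range (\<lambda>j. 1 - x * q ^ j)"
    by (rule has_prod_eq_0_iff)
  also have "\<dots> \<longleftrightarrow> (\<exists>j. x * q ^ j = 1)"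
    by (simp add: image_iff eq_commute[of 1])
  finally show ?thesis .
qed

lemma qpoch_inf_rec: "qpoch_inf q x = (1 - x) * qpoch_inf q (x * q)"
proof (cases "x = 1")
  case True
  then have "qpoch_inf q x = 0" unfolding qpoch_inf_eq_0_iff by (intro exI[of _ 0]) simp
  with True show ?thesis by simp
next
  case False
  then have "(\<Prod>n. 1 - x * q ^ Suc n) = (\<Prod>n. 1 - x * q ^ n) / (1 - x * q ^ 0)"
    by (intro prodinf_split_head convergent_qpoch_inf) auto
  with False show ?thesis by (simp add: qpoch_inf_def mult_ac)
qed

text \<open>A bound that gives the continuity of \<open>(x;q)\<^sub>\<infinity>\<close> at \<open>x = 0\<close>, which the passage to infinite
  parameters requires.\<close>
lemma norm_qpoch_inf_minus_1: "norm (qpoch_inf q x - 1) \<le> exp (norm x / (1 - norm q)) - 1"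
proof (rule LIMSEQ_le_const2)
  show "(\<lambda>n. norm ((\<Prod>j\<le>n. 1 - x * q ^ j) - 1)) \<longlonglongrightarrow> norm (qpoch_inf q x - 1)"
    unfolding qpoch_inf_def by (intro tendsto_intros convergent_prod_LIMSEQ convergent_qpoch_inf)
  have "norm ((\<Prod>j\<le>n. 1 - x * q ^ j) - 1) \<le> exp (norm x / (1 - norm q)) - 1" for n
  proof -
    have "norm ((\<Prod>j\<le>n. 1 + (- x * q ^ j)) - 1) \<le> (\<Prod>j\<le>n. 1 + norm (- x * q ^ j)) - 1"
      by (rule norm_prod_minus1_le_prod_minus1)
    also have "(\<Prod>j\<le>n. 1 + norm (- x * q ^ j)) \<le> exp (\<Sum>j\<le>n. norm (- x * q ^ j))"
      by (rule prod_le_exp_sum) auto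
    also have "(\<Sum>j\<le>n. norm (- x * q ^ j)) = norm x * (\<Sum>j\<le>n. norm q ^ j)"
      by (simp add: norm_mult norm_power sum_distrib_left)
    also have "\<dots> \<le> norm x * (\<Sum>j. norm q ^ j)"
      using q1 by (intro mult_left_mono sum_le_suminf) auto
    also have "\<dots> = norm x / (1 - norm q)"
      using q1 by (simp add: suminf_geometric divide_inverse)
    finally show ?thesis by simp
  qed
  then show "\<exists>N. \<forall>n\<ge>N. norm ((\<Prod>j\<le>n. 1 - x * q ^ j) - 1) \<le> exp (norm x / (1 - norm q)) - 1"
    by blast
qed

lemma qpoch_inf_tendsto_1:
  assumes "f \<longlonglongrightarrow> 0"
  shows "(\<lambda>n. qpoch_inf q (f n)) \<longlonglongrightarrow> 1"
proof -
  have "(\<lambda>n. exp (norm (f n) / (1 - norm q)) - 1) \<longlonglongrightarrow> exp (norm (0::complex) / (1 - norm q)) - 1"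
    using q1 by (intro tendsto_intros assms) auto
  then have lim: "(\<lambda>n. exp (norm (f n) / (1 - norm q)) - 1) \<longlonglongrightarrow> 0" by simp
  have "eventually (\<lambda>n. norm (qpoch_inf q (f n) - 1) \<le> exp (norm (f n) / (1 - norm q)) - 1) sequentially"
    by (intro always_eventually allI norm_qpoch_inf_minus_1)
  from Lim_null_comparison[OF this lim] show ?thesis by (simp add: LIM_zero_iff)
qed

lemma qpoch_0 [simp]: "qpoch q x 0 = 1"
  by (simp add: qpoch_def)

text \<open>
  For negative \<open>n\<close> a vanishing factor \<open>1 - x q\<^sup>n\<close> makes \<open>(x;q)\<^sub>n\<close> the inverse of zero, which is zero. The
  recurrence for \<open>(x;q)\<^sub>n\<close> then fails, while the one for its inverse holds; for nonnegative
  \<open>n\<close> the roles are exchanged.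
\<close>
lemma qpoch_Suc:
  assumes "n \<ge> 0 \<or> x * q powi n \<noteq> 1"
  shows "qpoch q x (n + 1) = qpoch q x n * (1 - x * q powi n)"
proof (cases "n \<ge> 0")
  case True
  then show ?thesis by (simp add: qpoch_def nat_add_distrib power_int_def)
next
  case False
  define m where "m = nat (- (n + 1))"
  have n: "nat (- n) = Suc m" "- int (Suc m) = n" using False by (simp_all add: m_def)
  have 1: "qpoch q x n = (\<Prod>j=1..m. inverse (1 - x * q powi (- int j))) * inverse (1 - x * q powi n)"
    using False n(2) unfolding qpoch_def n(1) by simp
  have 2: "qpoch q x (n + 1) = (\<Prod>j=1..m. inverse (1 - x * q powi (- int j)))"
    using False by (cases "m = 0") (auto simp: qpoch_def m_def)
  show ?thesis using assms False by (simp add: 1 2)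
qed

lemma inverse_qpoch_Suc:
  assumes "n < 0 \<or> x * q powi n \<noteq> 1"
  shows "inverse (qpoch q x (n + 1)) * (1 - x * q powi n) = inverse (qpoch q x n)"
proof (cases "n \<ge> 0")
  case True
  then show ?thesis using assms by (simp add: qpoch_def nat_add_distrib power_int_def)
next
  case False
  define m where "m = nat (- (n + 1))"
  have n: "nat (- n) = Suc m" "- int (Suc m) = n" using False by (simp_all add: m_def)
  have 1: "qpoch q x n = (\<Prod>j=1..m. inverse (1 - x * q powi (- int j))) * inverse (1 - x * q powi n)"
    using False n(2) unfolding qpoch_def n(1) by simp
  have 2: "qpoch q x (n + 1) = (\<Prod>j=1..m. inverse (1 - x * q powi (- int j)))"
    using False by (cases "m = 0") (auto simp: qpoch_def m_def)
  show ?thesis by (simp add: 1 2)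
qed

lemma qpoch_shift:
  assumes x: "\<And>n::int. x * q powi n \<noteq> 1"
  shows "qpoch q (x * q) n = qpoch q x n * (1 - x * q powi n) / (1 - x)"
proof -
  have w: "x * (q * q powi n) \<noteq> 1" for n
    using x[of "n + 1"] by (simp add: q_powi_Suc mult_ac)
  have "x \<noteq> 1" using x[of 0] by simp
  have 1: "qpoch q (x * q) (n + 1) * 1 = qpoch q (x * q) n * (1 - x * q * q powi n)" for n
    using w[of n] by (simp add: qpoch_Suc mult_ac)
  have 2: "(qpoch q x (n + 1) * (1 - x * q powi (n + 1)) / (1 - x)) * 1
      = qpoch q x n * (1 - x * q powi n) / (1 - x) * (1 - x * q * q powi n)" for n
    using x[of n] by (simp add: qpoch_Suc q_powi_Suc mult_ac)
  show ?thesis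
    by (rule two_sided_recurrence_unique[where f = "qpoch q (x * q)" and v = "\<lambda>_. 1"
          and g = "\<lambda>n. qpoch q x n * (1 - x * q powi n) / (1 - x)" and w = "\<lambda>n. 1 - x * q * q powi n", OF 1 2])
       (use w \<open>x \<noteq> 1\<close> in \<open>auto simp: mult_ac\<close>)
qed

section \<open>Well-poised factors\<close>

text \<open>
  The power of \<open>b\<close> is divided out so that the factor has a limit as \<open>b\<close> tends to infinity.
\<close>
definition wp :: "complex \<Rightarrow> complex \<Rightarrow> int \<Rightarrow> complex" where
  "wp a b n = qpoch q b n / (qpoch q (a * q / b) n * b powi n)"

text \<open>The parameters for which neither \<open>(b;q)\<^sub>n\<close> nor \<open>1/(aq/b;q)\<^sub>n\<close> has a pole at any integer \<open>n\<close>.\<close>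
definition wp_ok :: "complex \<Rightarrow> complex \<Rightarrow> bool" where
  "wp_ok a b \<longleftrightarrow> b \<noteq> 0 \<and> (\<forall>j>0. b \<noteq> q ^ j \<and> b \<noteq> a * q ^ j)"

lemma wp_0 [simp]: "wp a b 0 = 1"
  by (simp add: wp_def)

lemma wp_ok_neg: "wp_ok a b \<Longrightarrow> n < 0 \<Longrightarrow> b * q powi n \<noteq> 1"
  using q0 by (auto simp: wp_ok_def powi_neg field_simps)

lemma wp_ok_nonneg: "wp_ok a b \<Longrightarrow> n \<ge> 0 \<Longrightarrow> b - a * q powi (n + 1) \<noteq> 0"
proof -
  assume "wp_ok a b" "n \<ge> 0"
  moreover have "q powi (n + 1) = q ^ nat (n + 1)" using \<open>n \<ge> 0\<close> by (simp add: power_int_def)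
  ultimately show ?thesis by (auto simp: wp_ok_def)
qed

lemma wp_rec:
  assumes ok: "wp_ok a b"
  shows "wp a b (n + 1) * (b - a * q powi (n + 1)) = wp a b n * (1 - b * q powi n)"
proof -
  have b: "b \<noteq> 0" using ok by (simp add: wp_ok_def)
  have 1: "qpoch q b (n + 1) = qpoch q b n * (1 - b * q powi n)"
    using wp_ok_neg[OF ok] by (intro qpoch_Suc) force
  have "n < 0 \<or> a * q / b * q powi n \<noteq> 1"
    using wp_ok_nonneg[OF ok, of n, unfolded q_powi_Suc] b by (cases "n < 0") (auto simp: field_simps)
  note 2 = inverse_qpoch_Suc[OF this]
  have 3: "b powi (n + 1) = b powi n * b" using b by (simp add: power_int_add)
  have "b - a * q powi (n + 1) = b * (1 - a * q / b * q powi n)"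
    unfolding q_powi_Suc using b by (simp add: field_simps)
  then have "wp a b (n + 1) * (b - a * q powi (n + 1))
      = qpoch q b (n + 1) * (inverse (qpoch q (a * q / b) (n + 1)) * (1 - a * q / b * q powi n))
        * (inverse (b powi (n + 1)) * b)"
    by (simp only: wp_def divide_inverse inverse_mult_distrib mult_ac)
  also have "\<dots> = qpoch q b (n + 1) * inverse (qpoch q (a * q / b) n) * inverse (b powi n)"
  proof -
    have "inverse (b powi (n + 1)) * b = inverse (b powi n)" using b by (simp add: 3)
    then show ?thesis by (simp only: 2)
  qed
  also have "\<dots> = wp a b n * (1 - b * q powi n)"
    by (simp only: 1 wp_def divide_inverse inverse_mult_distrib mult_ac)
  finally show ?thesis .
qed

lemma wp_unique:
  assumes "wp_ok a b" "\<And>n. f (n + 1) * (b - a * q powi (n + 1)) = f n * (1 - b * q powi n)" "f 0 = 1"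
  shows "f n = wp a b n"
proof (rule two_sided_recurrence_unique[where f = f and g = "wp a b"])
  show "1 - b * q powi n \<noteq> 0" if "n < 0" for n
    using wp_ok_neg[OF assms(1) that] by simp
  show "b - a * q powi (n + 1) \<noteq> 0" if "n \<ge> 0" for n
    by (rule wp_ok_nonneg[OF assms(1) that])
qed (use assms wp_rec in auto)

lemma wp_ok_reflect: "a \<noteq> 0 \<Longrightarrow> wp_ok a b \<Longrightarrow> wp_ok (1 / a) (b / a)"
  by (auto simp: wp_ok_def field_simps)

text \<open>
  Reversing the order of summation replaces \<open>a\<close> by \<open>1/a\<close> and \<open>b\<close> by \<open>b/a\<close>. All estimates for negative
  indices are obtained in this way from those for nonnegative ones.
\<close>
lemma wp_reflect:
  assumes a: "a \<noteq> 0" and ok: "wp_ok a b"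
  shows "wp a b (- n) = q powi n * wp (1 / a) (b / a) n"
proof -
  have "q powi (- m) * wp (1 / a) (b / a) (- m) = wp a b m" for m
  proof (rule wp_unique[OF ok])
    fix m
    define x where "x = q powi m"
    have x: "x \<noteq> 0" "q powi (- m) = inverse x" "q powi (- (m + 1)) = inverse x / q" "q powi (m + 1) = x * q"
      unfolding power_int_minus x_def q_powi_Suc using q0 by (simp_all add: divide_inverse)
    have "wp (1 / a) (b / a) (- (m + 1) + 1) * (b / a - 1 / a * q powi (- (m + 1) + 1)) =
          wp (1 / a) (b / a) (- (m + 1)) * (1 - b / a * q powi (- (m + 1)))"
      by (rule wp_rec[OF wp_ok_reflect[OF a ok]])
    then have "wp (1 / a) (b / a) (- m) * (b / a - 1 / a * inverse x) =
          wp (1 / a) (b / a) (- (m + 1)) * (1 - b / a * (inverse x / q))"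
      unfolding x by (simp add: x)
    then have "a * (inverse x / q * wp (1 / a) (b / a) (- (m + 1)) * (b - a * (x * q))) =
        a * (inverse x * wp (1 / a) (b / a) (- m) * (1 - b * x))"
      using x(1) a q0 by (simp add: field_simps)
    then show "q powi - (m + 1) * wp (1 / a) (b / a) (- (m + 1)) * (b - a * q powi (m + 1)) =
        q powi - m * wp (1 / a) (b / a) (- m) * (1 - b * q powi m)"
      unfolding x x_def[symmetric] mult_left_cancel[OF a] .
  qed simp
  from this[of "- n"] show ?thesis by simp
qed

lemma wp_ok_div: "wp_ok a b \<Longrightarrow> wp_ok a (b / q)"
proof -
  assume ok: "wp_ok a b"
  have "b / q \<noteq> q ^ j \<and> b / q \<noteq> a * q ^ j" if "j > 0" for j
    using ok q0 that unfolding wp_ok_def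
    by (metis mult.assoc nonzero_divide_eq_eq power_Suc2 zero_less_Suc)
  then show ?thesis using ok q0 by (simp add: wp_ok_def)
qed

text \<open>In both \<open>(b;q)\<^sub>n\<close> and \<open>(aq/b;q)\<^sub>n\<close> the shift of the parameter changes only the first and the last factor.\<close>
lemma wp_shift:
  assumes ok: "wp_ok a (e * q)"
  shows "wp a (e * q) n = wp a e n * ((1 - e * q powi n) * (e - a * q powi n)) / ((1 - e) * (e - a) * q powi n)"
proof -
  have ok': "wp_ok a e" using wp_ok_div[OF ok] q0 by simp
  have e: "e \<noteq> 0" "e \<noteq> 1" "e \<noteq> a"
    using ok q0 unfolding wp_ok_def
    by (auto dest: spec[of _ 1])
  have "wp a e n * ((1 - e * q powi n) * (e - a * q powi n)) / ((1 - e) * (e - a) * q powi n) = wp a (e * q) n" for n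
  proof (rule wp_unique[OF ok])
    fix m
    define x where "x = q powi m"
    have x: "x \<noteq> 0" "q powi (m + 1) = x * q"
      using q0 by (auto simp: x_def q_powi_Suc)
    have "wp a e (m + 1) * (e - a * (x * q)) = wp a e m * (1 - e * x)"
      using wp_rec[OF ok', of m] by (simp add: x x_def)
    then have "(wp a e (m + 1) * (e - a * (x * q))) * ((1 - e * (x * q)) * (e - a * x)) / ((1 - e) * (e - a) * x)
        = (wp a e m * (1 - e * x)) * ((1 - e * (x * q)) * (e - a * x)) / ((1 - e) * (e - a) * x)"
      by simp
    moreover have "e * q - a * (x * q) = (e - a * x) * q" by (simp add: algebra_simps)
    ultimately show "wp a e (m + 1) * ((1 - e * q powi (m + 1)) * (e - a * q powi (m + 1))) / ((1 - e) * (e - a) * q powi (m + 1)) * (e * q - a * q powi (m + 1)) =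
       wp a e m * ((1 - e * q powi m) * (e - a * q powi m)) / ((1 - e) * (e - a) * q powi m) * (1 - e * q * q powi m)"
      unfolding x x_def[symmetric] using q0 by (simp add: mult_ac)
  qed (use e in auto)
  then show ?thesis by simp
qed

section \<open>Bilateral very well-poised sums\<close>

definition wp4 :: "complex \<Rightarrow> complex \<Rightarrow> complex \<Rightarrow> complex \<Rightarrow> complex \<Rightarrow> int \<Rightarrow> complex" where
  "wp4 a b c d e n = wp a b n * wp a c n * wp a d n * wp a e n"

definition wp4_ok :: "complex \<Rightarrow> complex \<Rightarrow> complex \<Rightarrow> complex \<Rightarrow> complex \<Rightarrow> bool" where
  "wp4_ok a b c d e \<longleftrightarrow> a \<noteq> 0 \<and> wp_ok a b \<and> wp_ok a c \<and> wp_ok a d \<and> wp_ok a e"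

definition wp_monom :: "nat \<Rightarrow> complex \<Rightarrow> complex \<Rightarrow> complex \<Rightarrow> complex \<Rightarrow> complex \<Rightarrow> int \<Rightarrow> complex" where
  "wp_monom k a b c d e n = (a^2) powi n * (q powi n) ^ k * wp4 a b c d e n"

text \<open>
  The sum \<open>psi\<close> is Bailey's very well-poised \<open>\<^sub>6\<psi>\<^sub>6\<close> series with argument \<open>a\<^sup>2q/bcde\<close>, multiplied by
  \<open>1 - a\<close>. Without the division the sum makes sense at \<open>a = 1\<close> too.
\<close>
definition psi_term :: "complex \<Rightarrow> complex \<Rightarrow> complex \<Rightarrow> complex \<Rightarrow> complex \<Rightarrow> int \<Rightarrow> complex" where
  "psi_term a b c d e n = (1 - a * (q powi n)^2) * q powi n * (a^2) powi n * wp4 a b c d e n"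

definition psi :: "complex \<Rightarrow> complex \<Rightarrow> complex \<Rightarrow> complex \<Rightarrow> complex \<Rightarrow> complex" where
  "psi a b c d e = infsum (psi_term a b c d e) UNIV"

lemma wp4_okD:
  assumes "wp4_ok a b c d e"
  shows "a \<noteq> 0" "wp_ok a b" "wp_ok a c" "wp_ok a d" "wp_ok a e" "b \<noteq> 0" "c \<noteq> 0" "d \<noteq> 0" "e \<noteq> 0"
  using assms by (auto simp: wp4_ok_def wp_ok_def)

lemma wp4_ok_reflect: "wp4_ok a b c d e \<Longrightarrow> wp4_ok (1 / a) (b / a) (c / a) (d / a) (e / a)"
  by (simp add: wp4_ok_def wp_ok_reflect)

lemma psi_term_eq_monoms:
  "psi_term a b c d e n = wp_monom 1 a b c d e n + (- a) * wp_monom 3 a b c d e n"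
  by (simp add: psi_term_def wp_monom_def algebra_simps power2_eq_square power3_eq_cube)

lemma wp_monom_reflect:
  assumes "wp4_ok a b c d e" "k \<le> 4"
  shows "wp_monom k a b c d e (- n) = wp_monom (4 - k) (1 / a) (b / a) (c / a) (d / a) (e / a) n"
proof -
  note ok = wp4_okD[OF assms(1)]
  define x where "x = q powi n"
  have x: "x \<noteq> 0" using q0 by (simp add: x_def)
  have 1: "(a^2) powi (- n) = ((1 / a)^2) powi n"
    by (simp add: power_int_minus power_int_inverse power_inverse divide_inverse)
  have 2: "inverse x ^ k * x ^ 4 = x ^ (4 - k)"
    using x assms(2) by (simp add: power_diff power_inverse divide_inverse mult_ac)
  have 3: "wp4 a b c d e (- n) = x ^ 4 * wp4 (1 / a) (b / a) (c / a) (d / a) (e / a) n"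
    using ok by (simp add: wp4_def wp_reflect x_def power4_eq_xxxx mult_ac)
  have "wp_monom k a b c d e (- n)
      = ((1 / a)^2) powi n * (inverse x ^ k * x ^ 4) * wp4 (1 / a) (b / a) (c / a) (d / a) (e / a) n"
    unfolding wp_monom_def 1 3 by (simp add: x_def power_int_minus mult_ac)
  then show ?thesis unfolding 2 by (simp add: wp_monom_def x_def)
qed

lemma psi_term_reflect:
  assumes "wp4_ok a b c d e"
  shows "psi_term a b c d e (- n) = - a * psi_term (1 / a) (b / a) (c / a) (d / a) (e / a) n"
  using wp_monom_reflect[OF assms, of 1 n] wp_monom_reflect[OF assms, of 3 n] wp4_okD(1)[OF assms]
  by (simp add: psi_term_eq_monoms algebra_simps)

text \<open>The ratio of consecutive terms tends to \<open>a\<^sup>2 q\<^sup>k/bcde\<close>, since each well-poised factor contributes \<open>1/b\<close> in the limit.\<close>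
lemma summable_wp_monom_half:
  assumes "wp4_ok a b c d e" and conv: "norm (a^2 / (b * c * d * e) * q ^ k) < 1"
  shows "summable (\<lambda>n. norm (wp_monom k a b c d e (int n)))"
proof (rule ratio_test_tendsto)
  note ok = wp4_okD[OF assms(1)]
  define r where "r b n = (1 - b * q ^ n) / (b - a * q ^ Suc n)" for b n
  let ?h = "\<lambda>n. a^2 * q ^ k * (r b n * r c n * r d n * r e n)"
  have wp: "wp a b (1 + int n) = r b n * wp a b (int n)" if "wp_ok a b" for b n
  proof -
    have *: "q powi (int n + 1) = q ^ Suc n" by (simp add: power_int_def nat_add_distrib)
    show ?thesis
      using wp_rec[OF that, of "int n"] wp_ok_nonneg[OF that, of "int n"]
      unfolding * r_def by (simp add: field_simps)
  qed
  have "wp_monom k a b c d e (int (Suc n)) = ?h n * wp_monom k a b c d e (int n)" for n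
    using ok wp by (simp add: wp_monom_def wp4_def power_int_add q0 power_mult_distrib power2_eq_square mult_ac)
  then show "eventually (\<lambda>n. wp_monom k a b c d e (int (Suc n)) = ?h n * wp_monom k a b c d e (int n)) sequentially"
    by simp
  have "r b \<longlonglongrightarrow> (1 - b * 0) / (b - a * 0)" if "b \<noteq> 0" for b
    unfolding r_def using that q1
    by (intro tendsto_intros LIMSEQ_power_zero filterlim_compose[OF LIMSEQ_power_zero filterlim_Suc]) auto
  then have r: "r b \<longlonglongrightarrow> 1 / b" if "b \<noteq> 0" for b using that by fastforce
  have "?h \<longlonglongrightarrow> a^2 * q ^ k * (1 / b * (1 / c) * (1 / d) * (1 / e))"
    using ok by (intro tendsto_intros r) auto
  also have "a^2 * q ^ k * (1 / b * (1 / c) * (1 / d) * (1 / e)) = a^2 / (b * c * d * e) * q ^ k" by simp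
  finally show "?h \<longlonglongrightarrow> a^2 / (b * c * d * e) * q ^ k" .
qed (rule conv)

lemma summable_wp_monom:
  assumes ok: "wp4_ok a b c d e" and k: "k \<le> 4"
    and conv: "norm (a^2 / (b * c * d * e) * q ^ k) < 1" "norm (a^2 / (b * c * d * e) * q ^ (4 - k)) < 1"
  shows "wp_monom k a b c d e summable_on UNIV"
proof -
  have a: "a \<noteq> 0" using ok by (simp add: wp4_ok_def)
  then have z: "(1 / a)^2 / (b / a * (c / a) * (d / a) * (e / a)) = a^2 / (b * c * d * e)"
    by (simp add: divide_simps) (simp add: power4_eq_xxxx)
  have "summable (\<lambda>n. norm (wp_monom (4 - k) (1 / a) (b / a) (c / a) (d / a) (e / a) (int n)))"
    by (intro summable_wp_monom_half wp4_ok_reflect ok) (unfold z, rule conv(2))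
  then have "summable (\<lambda>n. norm (wp_monom k a b c d e (- int n)))"
    by (simp add: wp_monom_reflect[OF ok k])
  then have "summable (\<lambda>n. norm (wp_monom k a b c d e (- int (Suc n))))"
    by (subst summable_Suc_iff)
  then show ?thesis
    using has_sum_int_halves[OF summable_wp_monom_half[OF ok conv(1)]] by (auto intro: has_sum_imp_summable)
qed

lemma norm_mult_q_power_less:
  assumes "norm x < 1" shows "norm (x * q ^ k) < 1"
proof -
  have "norm (x * q ^ k) \<le> norm x * 1"
    unfolding norm_mult norm_power using q1 by (intro mult_left_mono power_le_one) auto
  with assms show ?thesis by simp
qed

lemma psi_has_sum:
  assumes ok: "wp4_ok a b c d e" and conv: "norm (a^2 * q / (b * c * d * e)) < 1"
  shows "(psi_term a b c d e has_sum psi a b c d e) UNIV"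
proof -
  have lt: "norm (a^2 / (b * c * d * e) * q ^ Suc k) < 1" for k
    using norm_mult_q_power_less[OF conv, of k] by (simp add: mult_ac)
  have "wp_monom (Suc k) a b c d e summable_on UNIV" if "k \<le> 2" for k
  proof -
    have "norm (a^2 / (b * c * d * e) * q ^ (4 - Suc k)) < 1"
      using lt[of "2 - k"] that by (simp add: Suc_diff_le numeral_eq_Suc)
    then show ?thesis using that by (intro summable_wp_monom ok lt) auto
  qed
  from this[of 0] this[of 2] have "(\<lambda>n. wp_monom 1 a b c d e n + (- a) * wp_monom 3 a b c d e n) summable_on UNIV"
    by (intro summable_on_add summable_on_cmult_right) (auto simp: numeral_3_eq_3)
  then have "psi_term a b c d e summable_on UNIV" by (simp add: psi_term_eq_monoms[abs_def])
  then show ?thesis unfolding psi_def by (rule has_sum_infsum)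
qed

text \<open>
  Summation of \<open>T\<^sub>n - T\<^sub>n\<^sub>-\<^sub>1\<close>. Its polynomial factor is \<open>\<Prod>(1 - bx) - a\<^sup>-\<^sup>2 \<Prod>(b - ax)\<close> over the four parameters.
  The \<open>x\<^sup>2\<close> coefficients cancel, and the coefficients of \<open>x\<^sup>4\<close> and \<open>x\<^sup>3\<close> are \<open>- a\<^sup>2\<close> and \<open>- a\<close> times those of
  \<open>1\<close> and \<open>x\<close>; this is what produces the factor \<open>1 - a x\<^sup>2\<close>. The hypothesis on \<open>a\<^sup>2/bcde\<close> serves both for the
  convergence of the extreme powers of \<open>x\<close> and for \<open>A \<noteq> 0\<close>.
\<close>
lemma palindromic_has_sum:
  assumes ok: "wp4_ok a b c d e" and conv: "norm (a^2 / (b * c * d * e)) < 1"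
  defines "A \<equiv> 1 - b * c * d * e / a^2"
  defines "B \<equiv> (b * c * d + b * c * e + b * d * e + c * d * e) / a - (b + c + d + e)"
  shows "((\<lambda>n. (1 - a * (q powi n)^2) * (a^2) powi n * wp4 a b c d e n
              * (\<alpha> * (1 + a * (q powi n)^2) + \<beta> * q powi n))
           has_sum ((\<beta> - \<alpha> * B / A) * psi a b c d e)) UNIV"
proof -
  note nz = wp4_okD[OF ok]
  define T where "T n = (a^2) powi n * wp4 a b c d e n
      * ((1 - b * q powi n) * (1 - c * q powi n) * (1 - d * q powi n) * (1 - e * q powi n))" for n
  have A: "A \<noteq> 0"
  proof
    assume "A = 0"
    then have "a^2 / (b * c * d * e) = 1" using nz by (simp add: A_def field_simps)
    with conv show False by simp
  qed
  have summ: "wp_monom k a b c d e summable_on UNIV" if "k \<le> 4" for k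
    using that by (intro summable_wp_monom ok norm_mult_q_power_less conv)
  have T: "T n = wp_monom 0 a b c d e n + (- (b + c + d + e)) * wp_monom 1 a b c d e n
      + (b * c + b * d + b * e + c * d + c * e + d * e) * wp_monom 2 a b c d e n
      + (- (b * c * d + b * c * e + b * d * e + c * d * e)) * wp_monom 3 a b c d e n
      + b * c * d * e * wp_monom 4 a b c d e n" for n
    by (simp add: T_def wp_monom_def eval_nat_numeral algebra_simps)
  have "T summable_on UNIV"
    unfolding T[abs_def]
    by (intro summable_on_add summable_on_cmult_right summ) auto
  then obtain t where t: "(T has_sum t) UNIV" by (auto simp: summable_on_def)
  have "bij (\<lambda>n::int. n - 1)" by (rule bij_betw_byWitness[where f' = "\<lambda>n. n + 1"]) auto
  then have "((\<lambda>n. T (n - 1)) has_sum t) UNIV" using t has_sum_reindex_bij_betw by blast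
  from has_sum_add[OF t has_sum_cmult_right[OF this, of "- 1"]]
  have diff: "((\<lambda>n. T n - T (n - 1)) has_sum 0) UNIV" by simp
  have T': "T (n - 1) = (a^2) powi n * wp4 a b c d e n
      * ((b - a * q powi n) * (c - a * q powi n) * (d - a * q powi n) * (e - a * q powi n)) / a^2" for n
  proof -
    have r: "wp a b (n - 1) * (1 - b * q powi (n - 1)) = wp a b n * (b - a * q powi n)" if "wp_ok a b" for b
      using wp_rec[OF that, of "n - 1"] by simp
    have p: "(a^2) powi (n - 1) = (a^2) powi n / a^2" using nz by (simp add: power_int_diff)
    have "T (n - 1) = (a^2) powi n / a^2 * ((wp a b (n - 1) * (1 - b * q powi (n - 1))) * (wp a c (n - 1) * (1 - c * q powi (n - 1)))
       * (wp a d (n - 1) * (1 - d * q powi (n - 1))) * (wp a e (n - 1) * (1 - e * q powi (n - 1))))"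
      unfolding T_def p wp4_def by (simp only: mult_ac)
    then show ?thesis unfolding r[OF nz(2)] r[OF nz(3)] r[OF nz(4)] r[OF nz(5)]
      by (simp add: wp4_def mult_ac)
  qed
  have poly: "(1 - b * x) * (1 - c * x) * (1 - d * x) * (1 - e * x)
      - (b - a * x) * (c - a * x) * (d - a * x) * (e - a * x) / a^2
      = (1 - a * x^2) * (A * (1 + a * x^2) + B * x)" for x
    using nz by (simp add: A_def B_def field_simps) (simp add: algebra_simps power2_eq_square power4_eq_xxxx)
  have step: "T n - T (n - 1) = (a^2) powi n * wp4 a b c d e n
      * ((1 - a * (q powi n)^2) * (A * (1 + a * (q powi n)^2) + B * q powi n))" for n
    unfolding poly[symmetric] T' by (simp only: T_def right_diff_distrib times_divide_eq_right)
  have "((\<lambda>n. \<alpha> / A * (T n - T (n - 1)) + (\<beta> - \<alpha> * B / A) * psi_term a b c d e n) has_sum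
      \<alpha> / A * 0 + (\<beta> - \<alpha> * B / A) * psi a b c d e) UNIV"
    using norm_mult_q_power_less[OF conv, of 1]
    by (intro has_sum_add has_sum_cmult_right diff psi_has_sum ok) simp
  moreover have "\<alpha> / A * (T n - T (n - 1)) + (\<beta> - \<alpha> * B / A) * psi_term a b c d e n
      = (1 - a * (q powi n)^2) * (a^2) powi n * wp4 a b c d e n
              * (\<alpha> * (1 + a * (q powi n)^2) + \<beta> * q powi n)" for n
    unfolding step psi_term_def using A by (simp add: field_simps)
  ultimately show ?thesis by simp
qed

section \<open>The contiguous relation and its iteration\<close>

text \<open>The part of the product side of Bailey's formula that depends on \<open>b, c, d, e\<close>.\<close>
definition bailey_quotient :: "complex \<Rightarrow> complex \<Rightarrow> complex \<Rightarrow> complex \<Rightarrow> complex \<Rightarrow> complex" where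
  "bailey_quotient a b c d e =
     (qpoch_inf q (a * q / (b * c)) * qpoch_inf q (a * q / (b * d)) * qpoch_inf q (a * q / (b * e))
      * qpoch_inf q (a * q / (c * d)) * qpoch_inf q (a * q / (c * e)) * qpoch_inf q (a * q / (d * e)))
     / (qpoch_inf q (q / b) * qpoch_inf q (a * q / b) * qpoch_inf q (q / c) * qpoch_inf q (a * q / c)
        * qpoch_inf q (q / d) * qpoch_inf q (a * q / d) * qpoch_inf q (q / e) * qpoch_inf q (a * q / e)
        * qpoch_inf q (a^2 * q / (b * c * d * e)))"

lemma wp4_ok_perm: "wp4_ok a b c d e \<Longrightarrow> wp4_ok a e b c d"
  by (simp add: wp4_ok_def)

lemma psi_rotate: "psi a b c d e = psi a e b c d"
  unfolding psi_def by (intro infsum_cong) (simp add: psi_term_def wp4_def mult_ac)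

lemma bailey_quotient_rotate: "bailey_quotient a b c d e = bailey_quotient a e b c d"
  by (simp add: bailey_quotient_def mult_ac)

text \<open>
  By \<open>wp_shift\<close> the summand of \<open>\<psi>(b,c,d,eq)\<close> has, up to a constant factor, the quasi-palindromic
  polynomial \<open>(1 - ex)(e - ax)\<close> with \<open>\<alpha> = e\<close> and \<open>\<beta> = - (a + e\<^sup>2)\<close>, so
  \<open>palindromic_has_sum\<close> expresses it by \<open>\<psi>(b,c,d,e)\<close>. The constant factors completely, since \<open>\<beta> A - \<alpha> B\<close> equals \<open>- a (1 - be/a)(1 - ce/a)(1 - de/a)\<close>.
\<close>
lemma psi_contiguous:
  assumes ok: "wp4_ok a b c d (e * q)" and conv: "norm (a^2 / (b * c * d * e)) < 1"
  defines "R \<equiv> (1 - a / (b * e)) * (1 - a / (c * e)) * (1 - a / (d * e))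
      / ((1 - 1 / e) * (1 - a / e) * (1 - a^2 / (b * c * d * e)))"
  shows "psi a b c d (e * q) = R * psi a b c d e"
    and "bailey_quotient a b c d (e * q) = R * bailey_quotient a b c d e"
proof -
  have ok': "wp4_ok a b c d e"
    using ok wp_ok_div[of a "e * q"] q0 by (simp add: wp4_ok_def)
  note nz = wp4_okD[OF ok']
  have e: "e \<noteq> 1" "e \<noteq> a"
    using ok q0 unfolding wp4_ok_def wp_ok_def by (auto dest: spec[of _ 1])
  define z where "z = a^2 / (b * c * d * e)"
  have z: "z \<noteq> 1" using conv by (auto simp: z_def)
  define A where "A = 1 - b * c * d * e / a^2"
  define B where "B = (b * c * d + b * c * e + b * d * e + c * d * e) / a - (b + c + d + e)"
  have zA: "A = - (1 - z) / z" using nz z by (simp add: A_def z_def field_simps)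
  have A: "A \<noteq> 0" using zA z nz by (simp add: z_def)
  have term_eq: "psi_term a b c d (e * q) n = 1 / ((1 - e) * (e - a)) * 
      ((1 - a * (q powi n)^2) * (a^2) powi n * wp4 a b c d e n
              * (e * (1 + a * (q powi n)^2) + (- (a + e^2)) * q powi n))" for n
  proof -
    define x where "x = q powi n"
    have x: "x \<noteq> 0" using q0 by (simp add: x_def)
    have shift: "wp4 a b c d (e * q) n * x = wp4 a b c d e n * ((1 - e * x) * (e - a * x)) / ((1 - e) * (e - a))"
      using x wp_shift[of a e n] ok by (simp add: wp4_def x_def wp4_ok_def)
    have poly: "(1 - e * x) * (e - a * x) = e * (1 + a * x^2) + (- (a + e^2)) * x"
      by (simp add: algebra_simps power2_eq_square)
    have start: "psi_term a b c d (e * q) n = (1 - a * x^2) * (a^2) powi n * (wp4 a b c d (e * q) n * x)"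
      unfolding psi_term_def x_def by (simp only: mult_ac)
    show ?thesis unfolding start shift poly x_def[symmetric] by (simp add: mult_ac)
  qed
  have "(psi_term a b c d (e * q) has_sum 1 / ((1 - e) * (e - a)) * 
      ((- (a + e^2) - e * B / A) * psi a b c d e)) UNIV"
    unfolding term_eq[abs_def] A_def B_def
    by (intro has_sum_cmult_right palindromic_has_sum ok' conv)
  then have "psi a b c d (e * q) = 1 / ((1 - e) * (e - a)) * ((- (a + e^2) - e * B / A) * psi a b c d e)"
    unfolding psi_def by (rule infsumI)
  also have "- (a + e^2) - e * B / A = (- (a + e^2) * A - e * B) / A" using A by (simp add: field_simps)
  also have "- (a + e^2) * A - e * B = - a * (1 - b * e / a) * (1 - c * e / a) * (1 - d * e / a)"
    using nz by (simp add: A_def B_def divide_simps) (simp add: algebra_simps power2_eq_square power3_eq_cube)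
  also have "1 - b * e / a = - (b * e / a) * (1 - a / (b * e))" using nz by (simp add: field_simps)
  also have "1 - c * e / a = - (c * e / a) * (1 - a / (c * e))" using nz by (simp add: field_simps)
  also have "1 - d * e / a = - (d * e / a) * (1 - a / (d * e))" using nz by (simp add: field_simps)
  also have "1 / ((1 - e) * (e - a)) * (- a * (- (b * e / a) * (1 - a / (b * e))) * (- (c * e / a) * (1 - a / (c * e)))
       * (- (d * e / a) * (1 - a / (d * e))) / A * psi a b c d e)
     = ((1 - a / (b * e)) * (1 - a / (c * e)) * (1 - a / (d * e)))
       * (b * c * d * e^3 / a^2 / ((1 - e) * (e - a) * A)) * psi a b c d e"
    using nz by (simp add: power2_eq_square power3_eq_cube mult_ac)
  also have "b * c * d * e^3 / a^2 / ((1 - e) * (e - a) * A) = 1 / ((1 - 1 / e) * (1 - a / e) * (1 - z))"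
  proof -
    have 1: "1 - e = - e * (1 - 1 / e)" "e - a = e * (1 - a / e)" using nz by (simp_all add: field_simps)
    have 2: "b * c * d * e^3 / a^2 = e^2 / z" using nz by (simp add: z_def power2_eq_square power3_eq_cube)
    have 3: "z \<noteq> 0" using nz by (simp add: z_def)
    have "e^2 / z / ((- e * u) * (e * v) * (- w / z)) = 1 / (u * v * w)" for u v w
      using nz(9) 3 by (simp add: power2_eq_square)
    then show ?thesis unfolding zA 1 2 .
  qed
  finally show "psi a b c d (e * q) = R * psi a b c d e"
    by (simp add: R_def z_def)
  have r: "qpoch_inf q (x / e) = (1 - x / e) * qpoch_inf q (x * q / e)" for x
    using qpoch_inf_rec[of "x / e"] by simp
  have s: "qpoch_inf q (a * q / (b * (e * q))) = (1 - a / (b * e)) * qpoch_inf q (a * q / (b * e))" for b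
    using qpoch_inf_rec[of "a / (b * e)"] q0 by simp
  have t: "qpoch_inf q (q / (e * q)) = (1 - 1 / e) * qpoch_inf q (q / e)"
    "qpoch_inf q (a * q / (e * q)) = (1 - a / e) * qpoch_inf q (a * q / e)"
    "qpoch_inf q (a^2 * q / (b * c * d * (e * q))) = (1 - a^2 / (b * c * d * e)) * qpoch_inf q (a^2 * q / (b * c * d * e))"
    using r[of 1] r[of a] qpoch_inf_rec[of "a^2 / (b * c * d * e)"] q0 by (simp_all add: mult.assoc)
  show "bailey_quotient a b c d (e * q) = R * bailey_quotient a b c d e"
    unfolding bailey_quotient_def s t R_def by (simp only: times_divide_times_eq mult_ac)
qed

text \<open>
  The common factor is kept under an existential quantifier instead of dividing by the product side,
  which may vanish for some of the intermediate parameters.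
\<close>
definition shift_proportional where
  "shift_proportional a b c d e b' c' d' e' \<longleftrightarrow>
     (\<exists>R. psi a b c d e = R * psi a b' c' d' e' \<and> bailey_quotient a b c d e = R * bailey_quotient a b' c' d' e')"

lemma shift_proportional_trans:
  "shift_proportional a b c d e b' c' d' e' \<Longrightarrow> shift_proportional a b' c' d' e' b'' c'' d'' e''
   \<Longrightarrow> shift_proportional a b c d e b'' c'' d'' e''"
  unfolding shift_proportional_def by (metis mult.assoc)

lemma wp4_ok_div: "wp4_ok a b c d e \<Longrightarrow> wp4_ok a b c d (e / q)"
  by (simp add: wp4_ok_def wp_ok_div)

lemma shift_proportional_div:
  assumes "wp4_ok a b c d e" "norm (a^2 * q / (b * c * d * e)) < 1"
  shows "shift_proportional a b c d e (e / q) b c d"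
  unfolding shift_proportional_def psi_rotate[of a b c d "e / q", symmetric] bailey_quotient_rotate[of a b c d "e / q", symmetric]
proof -
  have e: "e / q * q = e" using q0 by simp
  have "norm (a^2 / (b * c * d * (e / q))) < 1" using assms(2) by simp
  from psi_contiguous[of a b c d "e / q", unfolded e, OF assms(1) this]
  show "\<exists>R. psi a b c d e = R * psi a b c d (e / q) \<and> bailey_quotient a b c d e = R * bailey_quotient a b c d (e / q)"
    by blast
qed

lemma shift_proportional_div_all:
  assumes ok: "wp4_ok a b c d e" and conv: "norm (a^2 * q / (b * c * d * e)) < 1"
  shows "shift_proportional a b c d e (b / q) (c / q) (d / q) (e / q)"
proof -
  have le: "norm (x * q / (y * (w / q))) < 1" if "norm (x * q / (y * w)) < 1" for x y w
    using norm_mult_q_power_less[OF that, of 1] by (simp add: mult_ac)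
  note ok1 = wp4_ok_perm[OF wp4_ok_div[OF ok]]
  note ok2 = wp4_ok_perm[OF wp4_ok_div[OF ok1]]
  note ok3 = wp4_ok_perm[OF wp4_ok_div[OF ok2]]
  have c1: "norm (a^2 * q / (e / q * b * c * d)) < 1" using le[OF conv] by (simp add: mult_ac)
  have c2: "norm (a^2 * q / (d / q * (e / q) * b * c)) < 1" using le[OF c1] by (simp add: mult_ac)
  have c3: "norm (a^2 * q / (c / q * (d / q) * (e / q) * b)) < 1" using le[OF c2] by (simp add: mult_ac)
  show ?thesis
    using shift_proportional_trans[OF shift_proportional_trans[OF shift_proportional_div[OF ok conv] shift_proportional_div[OF ok1 c1]]
      shift_proportional_trans[OF shift_proportional_div[OF ok2 c2] shift_proportional_div[OF ok3 c3]]] .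
qed

lemma shift_proportional_power:
  assumes ok: "wp4_ok a b c d e" and conv: "norm (a^2 * q / (b * c * d * e)) < 1"
  shows "shift_proportional a b c d e (b / q ^ N) (c / q ^ N) (d / q ^ N) (e / q ^ N)
         \<and> wp4_ok a (b / q ^ N) (c / q ^ N) (d / q ^ N) (e / q ^ N)"
proof (induction N)
  case 0
  then show ?case using ok by (auto simp: shift_proportional_def intro: exI[of _ 1])
next
  case (Suc N)
  have "norm (a^2 * q / (b / q ^ N * (c / q ^ N) * (d / q ^ N) * (e / q ^ N))) < 1"
    using norm_mult_q_power_less[OF conv, of "4 * N"]
    by (simp add: power_mult power4_eq_xxxx mult_ac power_mult_distrib[symmetric] mult.commute[of 4])
  from shift_proportional_div_all[OF _ this] Suc
  have "shift_proportional a (b / q ^ N) (c / q ^ N) (d / q ^ N) (e / q ^ N)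
      (b / q ^ N / q) (c / q ^ N / q) (d / q ^ N / q) (e / q ^ N / q)" by blast
  moreover have "wp4_ok a (b / q ^ N / q) (c / q ^ N / q) (d / q ^ N / q) (e / q ^ N / q)"
    using Suc unfolding wp4_ok_def by (intro conjI wp_ok_div) auto
  moreover have "x / q ^ N / q = x / q ^ Suc N" for x by simp
  ultimately show ?case using Suc shift_proportional_trans by metis
qed

lemma tendsto_q_power: "(\<lambda>N. q ^ N) \<longlonglongrightarrow> 0"
  using q1 by (rule LIMSEQ_power_zero)

section \<open>The limit of infinite parameters\<close>

lemma bailey_quotient_tendsto:
  assumes nz: "b \<noteq> 0" "c \<noteq> 0" "d \<noteq> 0" "e \<noteq> 0"
  shows "(\<lambda>N. bailey_quotient a (b / q ^ N) (c / q ^ N) (d / q ^ N) (e / q ^ N)) \<longlonglongrightarrow> 1"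
proof -
  have 1: "(\<lambda>N. qpoch_inf q (x / (b / q ^ N))) \<longlonglongrightarrow> 1" if "b \<noteq> 0" for x b
  proof (rule qpoch_inf_tendsto_1)
    have "(\<lambda>N. x / b * q ^ N) \<longlonglongrightarrow> x / b * 0" by (intro tendsto_intros tendsto_q_power)
    then show "(\<lambda>N. x / (b / q ^ N)) \<longlonglongrightarrow> 0" by simp
  qed
  have 2: "(\<lambda>N. qpoch_inf q (x / (b / q ^ N * (c / q ^ N)))) \<longlonglongrightarrow> 1" if "b \<noteq> 0" "c \<noteq> 0" for x b c
  proof (rule qpoch_inf_tendsto_1)
    have "(\<lambda>N. x / (b * c) * (q ^ N * q ^ N)) \<longlonglongrightarrow> x / (b * c) * (0 * 0)" by (intro tendsto_intros tendsto_q_power)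
    then show "(\<lambda>N. x / (b / q ^ N * (c / q ^ N))) \<longlonglongrightarrow> 0" by simp
  qed
  have 4: "(\<lambda>N. qpoch_inf q (x / (b / q ^ N * (c / q ^ N) * (d / q ^ N) * (e / q ^ N)))) \<longlonglongrightarrow> 1" for x
  proof (rule qpoch_inf_tendsto_1)
    have "(\<lambda>N. x / (b * c * d * e) * (q ^ N * q ^ N * q ^ N * q ^ N)) \<longlonglongrightarrow> x / (b * c * d * e) * (0 * 0 * 0 * 0)"
      by (intro tendsto_intros tendsto_q_power)
    then show "(\<lambda>N. x / (b / q ^ N * (c / q ^ N) * (d / q ^ N) * (e / q ^ N))) \<longlonglongrightarrow> 0" by simp
  qed
  have "(\<lambda>N. bailey_quotient a (b / q ^ N) (c / q ^ N) (d / q ^ N) (e / q ^ N))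
      \<longlonglongrightarrow> (1 * 1 * 1 * 1 * 1 * 1) / (1 * 1 * 1 * 1 * 1 * 1 * 1 * 1 * 1)"
    unfolding bailey_quotient_def by (intro tendsto_divide tendsto_mult 1 2 4 nz) simp
  then show ?thesis by simp
qed

text \<open>Each factor \<open>(1 - b q\<^sup>j)/(b - a q\<^sup>j\<^sup>+\<^sup>1)\<close> tends to \<open>- q\<^sup>j\<close> as \<open>b\<close> tends to infinity.\<close>
lemma wp_tendsto:
  assumes b: "b \<noteq> 0" and ok: "\<And>N. wp_ok a (b / q ^ N)"
  shows "(\<lambda>N. wp a (b / q ^ N) n) \<longlonglongrightarrow> (- 1) powi n * q powi (n * (n - 1) div 2)"
proof (induction n rule: int_induct[of _ 0])
  case base
  then show ?case by simp
next
  case (step1 n)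
  have 1: "wp a (b / q ^ N) (n + 1) = wp a (b / q ^ N) n * ((q ^ N - b * q powi n) / (b - a * q powi (n + 1) * q ^ N))" for N
    using wp_rec[OF ok, of N n] wp_ok_nonneg[OF ok, of n N] step1 q0 by (simp add: field_simps)
  have "(n + 1) * (n + 1 - 1) div 2 = n * (n - 1) div 2 + n"
    using triangular_step[of n] by simp
  then have 2: "(- 1) powi (n + 1) * q powi ((n + 1) * (n + 1 - 1) div 2)
      = (- 1) powi n * q powi (n * (n - 1) div 2) * ((0 - b * q powi n) / (b - a * q powi (n + 1) * 0))"
    using b q0 by (simp add: power_int_add)
  show ?case unfolding 1 2 by (intro tendsto_intros step1 tendsto_q_power) (use b in simp)
next
  case (step2 n)
  have r: "wp a (b / q ^ N) n * (b / q ^ N - a * q powi n) = wp a (b / q ^ N) (n - 1) * (1 - b / q ^ N * q powi (n - 1))" for N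
    using wp_rec[OF ok, of N "n - 1"] by simp
  have nz: "b / q ^ N * q powi (n - 1) \<noteq> 1" for N
    using wp_ok_neg[OF ok, of "n - 1" N] step2 by simp
  have 1: "wp a (b / q ^ N) (n - 1) = wp a (b / q ^ N) n * ((b - a * q powi n * q ^ N) / (q ^ N - b * q powi (n - 1)))" for N
  proof -
    have "q ^ N - b * q powi (n - 1) \<noteq> 0" using nz[of N] q0 by (auto simp: field_simps)
    then show ?thesis using r[of N] q0 by (simp add: field_simps)
  qed
  have "n * (n - 1) div 2 = (n - 1) * (n - 1 - 1) div 2 + (n - 1)"
    using triangular_step[of "n - 1"] by simp
  then have 2: "(- 1) powi (n - 1) * q powi ((n - 1) * (n - 1 - 1) div 2)
      = (- 1) powi n * q powi (n * (n - 1) div 2) * ((b - a * q powi n * 0) / (0 - b * q powi (n - 1)))"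
    using b q0 by (simp add: power_int_add power_int_diff)
  show ?case unfolding 1 2 by (intro tendsto_intros step2 tendsto_q_power) (use b q0 in simp)
qed

text \<open>
  These are consecutive pairs of terms of the theta series \<open>\<Sum>\<^sub>m (-1)\<^sup>m q\<^sup>m\<^sup>(\<^sup>m\<^sup>-\<^sup>1\<^sup>)\<^sup>/\<^sup>2 a\<^sup>m\<close>, with
  \<open>m = 2n\<close> and \<open>m = 2n + 1\<close>.
\<close>
definition theta_term :: "complex \<Rightarrow> int \<Rightarrow> complex" where
  "theta_term a n = (1 - a * (q powi n)^2) * q powi n * (a^2) powi n * q powi (2 * n * (n - 1))"

lemma psi_term_tendsto:
  assumes ok: "\<And>N. wp4_ok a (b / q ^ N) (c / q ^ N) (d / q ^ N) (e / q ^ N)"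
  shows "(\<lambda>N. psi_term a (b / q ^ N) (c / q ^ N) (d / q ^ N) (e / q ^ N) n) \<longlonglongrightarrow> theta_term a n"
proof -
  have oks: "b \<noteq> 0" "c \<noteq> 0" "d \<noteq> 0" "e \<noteq> 0" 
    using wp4_okD[OF ok[of 0]] by auto
  define r where "r = (- 1) powi n * q powi (n * (n - 1) div 2)"
  have wp: "(\<lambda>N. wp4 a (b / q ^ N) (c / q ^ N) (d / q ^ N) (e / q ^ N) n) \<longlonglongrightarrow> r * r * r * r"
    unfolding wp4_def r_def using ok oks by (intro tendsto_mult wp_tendsto) (auto simp: wp4_ok_def)
  have r2: "r * r = q powi (n * (n - 1))"
  proof -
    have "even (n * (n - 1))" by simp
    moreover have "x = x div 2 + x div 2" if "even x" for x :: int using that by presburger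
    ultimately have "n * (n - 1) = n * (n - 1) div 2 + n * (n - 1) div 2" by blast
    then have "q powi (n * (n - 1)) = q powi (n * (n - 1) div 2) * q powi (n * (n - 1) div 2)"
      using q0 by (metis power_int_add)
    then show ?thesis by (simp add: r_def mult_ac flip: power_int_mult_distrib)
  qed
  have "r * r * r * r = (r * r) * (r * r)" by (simp only: mult_ac)
  also have "\<dots> = q powi (n * (n - 1) + n * (n - 1))"
    unfolding r2 using q0 by (subst power_int_add) auto
  finally have "r * r * r * r = q powi (n * (n - 1) + n * (n - 1))" .
  then have r4: "r * r * r * r = q powi (2 * n * (n - 1))" by (simp add: algebra_simps)
  show ?thesis unfolding psi_term_def theta_term_def r4[symmetric] by (intro tendsto_intros wp)
qed

text \<open>
  Consecutive values have ratio tending to \<open>\<delta>/(1 - \<delta>)\<close>, so for small \<open>\<delta>\<close> the fourth power of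
  this sequence is summable against any prescribed geometric growth. The sequence dominates
  all well-poised factors whose parameter is large in terms of \<open>\<delta>\<close>.
\<close>
definition wp_majorant :: "real \<Rightarrow> nat \<Rightarrow> real" where
  "wp_majorant \<delta> n = (\<Prod>j<n. (\<delta> + norm q ^ j) / (1 - \<delta>))"

lemma wp_majorant_Suc:
  "wp_majorant \<delta> (Suc n) = wp_majorant \<delta> n * ((\<delta> + norm q ^ n) / (1 - \<delta>))"
  by (simp add: wp_majorant_def)

lemma norm_wp_le:
  assumes ok: "wp_ok a b" and \<delta>: "\<delta> < 1" and b: "1 \<le> \<delta> * norm b" "norm a \<le> \<delta> * norm b"
  shows "norm (wp a b (int n)) \<le> wp_majorant \<delta> n"
proof (induction n)
  case 0
  then show ?case by (simp add: wp_majorant_def)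
next
  case (Suc n)
  have b0: "norm b > 0" using ok by (simp add: wp_ok_def)
  have "\<delta> * norm b > 0" using b(1) by linarith
  then have \<delta>0: "\<delta> > 0" using b0 by (simp add: zero_less_mult_iff)
  have e: "q powi (int n + 1) = q ^ Suc n" by (simp add: power_int_def nat_add_distrib)
  have den: "b - a * q ^ Suc n \<noteq> 0" using wp_ok_nonneg[OF ok, of "int n"] unfolding e by simp
  have eq: "wp a b (int (Suc n)) = wp a b (int n) * ((1 - b * q ^ n) / (b - a * q ^ Suc n))"
    using wp_rec[OF ok, of "int n"] den unfolding e by (simp add: field_simps)
  have "norm (1 - b * q ^ n) \<le> 1 + norm b * norm q ^ n"
    using norm_triangle_ineq4[of 1 "b * q ^ n"] by (simp add: norm_mult norm_power)
  also have "\<dots> \<le> (\<delta> + norm q ^ n) * norm b" using b(1) by (simp add: algebra_simps)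
  finally have num: "norm (1 - b * q ^ n) \<le> (\<delta> + norm q ^ n) * norm b" .
  have "norm (a * q ^ Suc n) \<le> norm a * 1"
    unfolding norm_mult norm_power using q1 by (intro mult_left_mono power_le_one) auto
  then have "norm (b - a * q ^ Suc n) \<ge> norm b - norm a"
    using norm_triangle_ineq2[of b "a * q ^ Suc n"] by linarith
  then have den': "norm (b - a * q ^ Suc n) \<ge> (1 - \<delta>) * norm b" using b(2) by (simp add: algebra_simps)
  have "norm ((1 - b * q ^ n) / (b - a * q ^ Suc n)) \<le> ((\<delta> + norm q ^ n) * norm b) / ((1 - \<delta>) * norm b)"
    unfolding norm_divide using num den' b0 \<delta> \<delta>0 by (intro frac_le) auto
  also have "\<dots> = (\<delta> + norm q ^ n) / (1 - \<delta>)" using b0 by simp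
  finally show ?case
    unfolding eq norm_mult wp_majorant_Suc using Suc by (intro mult_mono order_trans[OF norm_ge_zero Suc]) auto
qed

lemma summable_wp_majorant:
  assumes \<delta>: "0 < \<delta>" "\<delta> < 1" and \<kappa>: "\<kappa> \<ge> 0" "\<kappa> * (\<delta> / (1 - \<delta>)) ^ 4 < 1"
  shows "summable (\<lambda>n. C * \<kappa> ^ n * wp_majorant \<delta> n ^ 4)"
proof -
  let ?h = "\<lambda>n. \<kappa> * ((\<delta> + norm q ^ n) / (1 - \<delta>)) ^ 4"
  have "summable (\<lambda>n. norm (C * \<kappa> ^ n * wp_majorant \<delta> n ^ 4))"
  proof (rule ratio_test_tendsto)
    show "eventually (\<lambda>n. C * \<kappa> ^ Suc n * wp_majorant \<delta> (Suc n) ^ 4 = ?h n * (C * \<kappa> ^ n * wp_majorant \<delta> n ^ 4)) sequentially"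
      by (intro always_eventually allI) (simp only: wp_majorant_Suc power_Suc power_mult_distrib mult_ac)
    have "?h \<longlonglongrightarrow> \<kappa> * ((\<delta> + 0) / (1 - \<delta>)) ^ 4"
      using q1 \<delta> by (intro tendsto_intros LIMSEQ_power_zero) auto
    then show "?h \<longlonglongrightarrow> \<kappa> * (\<delta> / (1 - \<delta>)) ^ 4" by simp
    show "norm (\<kappa> * (\<delta> / (1 - \<delta>)) ^ 4) < 1" using \<kappa> \<delta> by (simp add: abs_mult)
  qed
  then show ?thesis by (rule summable_norm_cancel)
qed

lemma norm_psi_term_le:
  assumes ok: "wp4_ok a b c d e" and \<delta>: "\<delta> < 1"
    and large: "\<And>x. x \<in> {b, c, d, e} \<Longrightarrow> 1 \<le> \<delta> * norm x \<and> norm a \<le> \<delta> * norm x"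
  shows "norm (psi_term a b c d e (int n)) \<le> (1 + norm a) * norm (a^2 * q) ^ n * wp_majorant \<delta> n ^ 4"
proof -
  note oks = wp4_okD[OF ok]
  have M: "norm (wp a x (int n)) \<le> wp_majorant \<delta> n" if "x \<in> {b, c, d, e}" for x
    using that large[OF that] oks \<delta> by (intro norm_wp_le) auto
  then have M0: "wp_majorant \<delta> n \<ge> 0" using norm_ge_zero order_trans by blast
  have 1: "norm (wp4 a b c d e (int n)) \<le> wp_majorant \<delta> n ^ 4"
    unfolding wp4_def norm_mult power4_eq_xxxx using M0 by (intro mult_mono M) auto
  have "norm (a * (q ^ n)^2) \<le> norm a * 1"
    unfolding norm_mult norm_power using q1 by (intro mult_left_mono power_le_one) auto
  then have 2: "norm (1 - a * (q ^ n)^2) \<le> 1 + norm a"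
    using norm_triangle_ineq4[of 1 "a * (q ^ n)^2"] by simp
  have "norm (psi_term a b c d e (int n)) = norm (1 - a * (q ^ n)^2) * norm (a^2 * q) ^ n * norm (wp4 a b c d e (int n))"
    by (simp add: psi_term_def norm_mult norm_power power_mult_distrib mult_ac flip: power_mult)
  also have "\<dots> \<le> (1 + norm a) * norm (a^2 * q) ^ n * wp_majorant \<delta> n ^ 4"
    using 1 2 by (intro mult_mono) auto
  finally show ?thesis .
qed

text \<open>
  Dominated convergence. One \<open>\<delta>\<close> has to serve both half-lines, where the geometric factors are
  \<open>a\<^sup>2q\<close> and \<open>q/a\<^sup>2\<close>; reflection leaves the two largeness conditions on the parameters
  unchanged, since it merely exchanges them.
\<close>
lemma psi_tendsto:
  assumes ok: "\<And>N. wp4_ok a (b / q ^ N) (c / q ^ N) (d / q ^ N) (e / q ^ N)"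
  shows "(\<lambda>N. psi a (b / q ^ N) (c / q ^ N) (d / q ^ N) (e / q ^ N)) \<longlonglongrightarrow> infsum (theta_term a) UNIV"
proof -
  have a: "a \<noteq> 0" using wp4_okD[OF ok[of 0]] by simp
  \<comment> \<open>\<open>\<delta>/(1 - \<delta>) \<le> 2\<delta> = 1/(1 + D)\<close> is at most 1, so its fourth power times \<open>D\<close> is below 1.\<close>
  define D where "D = norm (a^2 * q) + norm ((1 / a)^2 * q)"
  define \<delta> where "\<delta> = 1 / (2 * (1 + D))"
  have D: "D \<ge> 0" by (simp add: D_def)
  have \<delta>: "0 < \<delta>" "\<delta> \<le> 1 / 2" using D by (auto simp: \<delta>_def field_simps)
  have small: "\<kappa> * (\<delta> / (1 - \<delta>)) ^ 4 < 1" if "\<kappa> \<ge> 0" "\<kappa> \<le> D" for \<kappa>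
  proof -
    have "\<delta> / (1 - \<delta>) \<le> \<delta> / (1 / 2)" using \<delta> by (intro divide_left_mono) auto
    also have "\<dots> = 1 / (1 + D)" using D by (simp add: \<delta>_def field_simps)
    finally have le: "\<delta> / (1 - \<delta>) \<le> 1 / (1 + D)" .
    have "(\<delta> / (1 - \<delta>)) ^ 4 \<le> (1 / (1 + D)) ^ 4" using le \<delta> by (intro power_mono) auto
    also have "\<dots> \<le> (1 / (1 + D)) ^ 1" using D by (intro power_decreasing) auto
    finally have "\<kappa> * (\<delta> / (1 - \<delta>)) ^ 4 \<le> D * (1 / (1 + D))"
      using that \<delta> by (intro mult_mono) auto
    also have "\<dots> < 1" using D by (simp add: field_simps)
    finally show ?thesis .
  qed
  have ev1: "eventually (\<lambda>N. y \<le> \<delta> * norm (x / q ^ N)) sequentially" if "x \<noteq> 0" for x :: complex and y :: real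
  proof -
    have "(\<lambda>N. y * norm (q ^ N)) \<longlonglongrightarrow> y * norm (0::complex)"
      by (intro tendsto_intros tendsto_q_power)
    then have "eventually (\<lambda>N. y * norm (q ^ N) < \<delta> * norm x) sequentially"
      using \<delta> that by (intro order_tendstoD(2)) auto
    then show ?thesis
      by eventually_elim (use q0 in \<open>simp add: norm_divide field_simps\<close>)
  qed
  have ev: "eventually (\<lambda>N. \<forall>x\<in>{b, c, d, e}. 1 \<le> \<delta> * norm (x / q ^ N) \<and> norm a \<le> \<delta> * norm (x / q ^ N)) sequentially"
    using ev1 wp4_okD[OF ok[of 0]] by (simp add: eventually_conj_iff del: norm_divide)
  let ?M = "\<lambda>a n. (1 + norm a) * norm (a^2 * q) ^ n * wp_majorant \<delta> n ^ 4"
  have b1: "eventually (\<lambda>N. \<forall>n. norm (psi_term a (b / q ^ N) (c / q ^ N) (d / q ^ N) (e / q ^ N) (int n)) \<le> ?M a n) sequentially"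
    using ev
  proof eventually_elim
    case (elim N)
    then show ?case using \<delta> by (intro allI norm_psi_term_le ok) auto
  qed
  have b2: "eventually (\<lambda>N. \<forall>n. norm (psi_term a (b / q ^ N) (c / q ^ N) (d / q ^ N) (e / q ^ N) (- int (Suc n)))
      \<le> norm a * ?M (1 / a) (Suc n)) sequentially"
    using ev
  proof eventually_elim
    case (elim N)
    have *: "1 \<le> \<delta> * norm (x / q ^ N / a) \<and> norm (1 / a) \<le> \<delta> * norm (x / q ^ N / a)" if "x \<in> {b, c, d, e}" for x
      using elim that a unfolding norm_divide[of _ a] by (auto simp: field_simps)
    have le: "norm (psi_term (1 / a) (b / q ^ N / a) (c / q ^ N / a) (d / q ^ N / a) (e / q ^ N / a) (int m)) \<le> ?M (1 / a) m" for m
      using \<delta> * by (intro norm_psi_term_le wp4_ok_reflect ok) auto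
    show ?case unfolding psi_term_reflect[OF ok] norm_mult[of "- a"] norm_minus_cancel
      by (intro allI mult_left_mono le norm_ge_zero)
  qed
  have s1: "summable (?M a)"
    using \<delta> by (intro summable_wp_majorant small) (auto simp: D_def)
  have "summable (?M (1 / a))"
    using \<delta> by (intro summable_wp_majorant small) (auto simp: D_def)
  then have s2: "summable (\<lambda>n. norm a * ?M (1 / a) (Suc n))"
    by (intro summable_mult) (subst summable_Suc_iff)
  note T = tannery_bilateral[OF psi_term_tendsto[OF ok] b1 b2 s1 s2]
  show "(\<lambda>N. psi a (b / q ^ N) (c / q ^ N) (d / q ^ N) (e / q ^ N)) \<longlonglongrightarrow> infsum (theta_term a) UNIV"
    using T unfolding psi_def .
qed

lemma psi_eq_bailey_quotient_theta:
  assumes ok: "wp4_ok a b c d e" and conv: "norm (a^2 * q / (b * c * d * e)) < 1"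
  shows "psi a b c d e = bailey_quotient a b c d e * infsum (theta_term a) UNIV"
proof -
  let ?P = "\<lambda>N. psi a (b / q ^ N) (c / q ^ N) (d / q ^ N) (e / q ^ N)"
  let ?K = "\<lambda>N. bailey_quotient a (b / q ^ N) (c / q ^ N) (d / q ^ N) (e / q ^ N)"
  note nz = wp4_okD[OF ok]
  have ok': "wp4_ok a (b / q ^ N) (c / q ^ N) (d / q ^ N) (e / q ^ N)" for N
    using shift_proportional_power[OF ok conv] by blast
  have "psi a b c d e * ?K N = bailey_quotient a b c d e * ?P N" for N
    using shift_proportional_power[OF ok conv, of N] by (auto simp: shift_proportional_def)
  moreover have "(\<lambda>N. psi a b c d e * ?K N) \<longlonglongrightarrow> psi a b c d e * 1"
    using nz by (intro tendsto_intros bailey_quotient_tendsto)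
  moreover have "(\<lambda>N. bailey_quotient a b c d e * ?P N) \<longlonglongrightarrow> bailey_quotient a b c d e * infsum (theta_term a) UNIV"
    by (intro tendsto_intros psi_tendsto ok')
  ultimately show ?thesis using LIMSEQ_unique by fastforce
qed

lemma norm_q_power_le_1: "norm (q ^ j) \<le> 1"
  using q1 by (simp add: norm_power power_le_one)

section \<open>Bailey's summation formula\<close>

text \<open>
  At \<open>d = 1\<close> and \<open>e = a\<close> the factor of \<open>d\<close> vanishes for \<open>n > 0\<close> and that of \<open>e\<close> for \<open>n < 0\<close>, so \<open>\<psi> = 1 - a\<close>
  there, and the theta series can be read off. The remaining parameters \<open>b = c\<close> are taken large
  enough for convergence. These values are admissible if \<open>a\<close> is not an integral power of \<open>q\<close>; for
  integral powers both sides vanish, the left one because the terms are antisymmetric under a reflection of \<open>n\<close>.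
\<close>
lemma infsum_theta_term:
  assumes a: "a \<noteq> 0"
  shows "infsum (theta_term a) UNIV = (1 - a) * qpoch_inf q q * qpoch_inf q (a * q) * qpoch_inf q (q / a)"
proof (cases "\<exists>m. a = q powi m")
  case True
  then obtain m where m: "a = q powi m" by blast
  have "theta_term a (- m - n) = - theta_term a n" for n
  proof -
    define E where "E n = n + 2 * m * n + 2 * n * (n - 1)" for n
    have p: "q powi x * q powi y = q powi (x + y)" for x y
      using q0 by (subst power_int_add) auto
    have a2: "(a^2) powi n = q powi (2 * m * n)" for n
    proof -
      have "a^2 = q powi (2 * m)" by (simp add: m power2_eq_square p)
      then show ?thesis by (simp add: power_int_mult)
    qed
    have aq: "a * (q powi n)^2 = q powi (m + 2 * n)" for n
      unfolding m power2_eq_square p by (simp add: algebra_simps)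
    have eq: "theta_term a n = q powi E n - q powi (m + 2 * n + E n)" for n
      unfolding theta_term_def aq a2 left_diff_distrib mult_1_left p E_def by (simp only: add_ac)
    have "E (- m - n) = m + 2 * n + E n" "m + 2 * (- m - n) + E (- m - n) = E n"
      by (simp_all add: E_def algebra_simps)
    then show ?thesis unfolding eq by simp
  qed
  moreover have "bij (\<lambda>n. - m - n)" by (rule bij_betw_byWitness[where f' = "\<lambda>n. - m - n"]) auto
  then have "infsum (\<lambda>n. theta_term a (- m - n)) UNIV = infsum (theta_term a) UNIV"
    by (rule infsum_reindex_bij_betw)
  ultimately have "- infsum (theta_term a) UNIV = infsum (theta_term a) UNIV"
    by (simp add: infsum_uminus)
  then have 0: "infsum (theta_term a) UNIV = 0"
    by (simp add: complex_eq_iff)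
  have "a = 1 \<or> qpoch_inf q (a * q) = 0 \<or> qpoch_inf q (q / a) = 0"
  proof (cases "m = 0")
    case False
    define k where "k = nat (\<bar>m\<bar> - 1)"
    show ?thesis
    proof (cases "m > 0")
      case True
      then have "a = q ^ Suc k" by (simp add: m k_def power_int_def Suc_diff_1 nat_diff_distrib')
      then have "q / a * q ^ k = 1" using q0 by simp
      then show ?thesis unfolding qpoch_inf_eq_0_iff by blast
    next
      case neg: False
      then have "nat (- m) = Suc k" using False by (simp add: k_def)
      then have "a = inverse (q ^ Suc k)" using neg False powi_neg[of m] m by simp
      then have "a * q * q ^ k = 1" using q0 by (simp add: field_simps)
      then show ?thesis unfolding qpoch_inf_eq_0_iff by blast
    qed
  qed (simp add: m)
  then show ?thesis by (auto simp: 0)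
next
  case False
  then have "a \<noteq> q powi (- int j)" "a \<noteq> q powi int j" for j by blast+
  then have a1: "a * q ^ j \<noteq> 1" "a \<noteq> q ^ j" for j
    using q0 by (auto simp: power_int_minus field_simps)
  \<comment> \<open>This modulus exceeds those of \<open>q\<^sup>j\<close> and \<open>a q\<^sup>j\<close> for all \<open>j \<ge> 1\<close> and gives \<open>aq/t\<^sup>2\<close> modulus below 1.\<close>
  define t :: complex where "t = of_real (1 + norm a)"
  have nt: "norm t = 1 + norm a" unfolding t_def norm_of_real by simp
  then have "norm t > 0" using norm_ge_zero[of a] by linarith
  then have t0: "t \<noteq> 0" by auto
  have ta: "norm (a * q ^ j) < norm t" "norm (q ^ j) < norm t" if "j > 0" for j
  proof -
    have "norm a * norm (q ^ j) \<le> norm a * 1" by (intro mult_left_mono norm_q_power_le_1) auto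
    then show "norm (a * q ^ j) < norm t" by (simp add: norm_mult nt)
    show "norm (q ^ j) < norm t" using q_power_lt_1[OF that] nt norm_ge_zero[of a] by linarith
  qed
  have okt: "wp_ok a t" unfolding wp_ok_def using ta t0 by (metis less_irrefl)
  have ok1: "wp_ok a 1" using a1 q_power_ne_1 by (auto simp: wp_ok_def)
  have oka: "wp_ok a a" using a1 a q_power_ne_1 by (auto simp: wp_ok_def)
  have ok: "wp4_ok a t t 1 a" using okt ok1 oka a by (simp add: wp4_ok_def)
  have lt_t: "norm (x / t) < 1" if "norm x < norm t" for x using that t0 by (simp add: norm_divide)
  have aqt2: "norm (a * q / (t * t)) < 1"
  proof -
    have "norm (a * q / (t * t)) = norm (a * q ^ 1 / t) / norm t" by (simp add: norm_divide norm_mult)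
    also have "\<dots> \<le> norm (a * q ^ 1 / t) / 1"
      using nt \<open>norm t > 0\<close> norm_ge_zero[of a] by (intro divide_left_mono) (linarith | simp)+
    also have "\<dots> < 1" using lt_t[OF ta(1)[of 1]] by simp
    finally show ?thesis .
  qed
  have nz: "qpoch_inf q x \<noteq> 0" if "norm x < 1" for x
  proof
    assume "qpoch_inf q x = 0"
    then obtain j where "x * q ^ j = 1" by (auto simp: qpoch_inf_eq_0_iff)
    with norm_mult_q_power_less[OF that, of j] show False by simp
  qed
  have "psi_term a t t 1 a n = (if n = 0 then 1 - a else 0)" for n
  proof -
    have "wp a 1 n = 0" if "n > 0"
      using that by (auto simp: wp_def qpoch_def intro!: bexI[of _ 0])
    moreover have "wp a a n = 0" if "n < 0"
      using that q0 a by (auto simp: wp_def qpoch_def intro!: bexI[of _ 1])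
    ultimately show ?thesis
      by (cases "n = 0"; cases "n > 0") (auto simp: psi_term_def wp4_def)
  qed
  then have "psi a t t 1 a = infsum (\<lambda>n. if n = 0 then 1 - a else 0) (UNIV :: int set)"
    unfolding psi_def by presburger
  also have "\<dots> = infsum (\<lambda>n. if n = 0 then 1 - a else 0) {0 :: int}" by (rule infsum_cong_neutral) auto
  finally have psi: "psi a t t 1 a = 1 - a" by simp
  have nz': "qpoch_inf q (a * q / (t * t)) \<noteq> 0" "qpoch_inf q (a * q / t) \<noteq> 0" "qpoch_inf q (q / t) \<noteq> 0" "qpoch_inf q q \<noteq> 0"
    using aqt2 lt_t ta[of 1] q1 by (auto intro!: nz)
  have "bailey_quotient a t t 1 a = 1 / (qpoch_inf q q * qpoch_inf q (a * q) * qpoch_inf q (q / a))"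
  proof -
    have "a^2 * q / (t * t * 1 * a) = a * q / (t * t)" using a by (simp add: power2_eq_square)
    then show ?thesis
      using nz' a by (simp add: bailey_quotient_def)
  qed
  moreover have "norm (a^2 * q / (t * t * 1 * a)) < 1" using aqt2 a by (simp add: power2_eq_square)
  ultimately have "1 - a = 1 / (qpoch_inf q q * qpoch_inf q (a * q) * qpoch_inf q (q / a)) * infsum (theta_term a) UNIV"
    using psi_eq_bailey_quotient_theta[OF ok] psi by simp
  moreover have "qpoch_inf q (a * q) \<noteq> 0" 
    unfolding qpoch_inf_eq_0_iff using a1(1)[of "Suc _"] by (auto simp: mult_ac)
  moreover have "qpoch_inf q (q / a) \<noteq> 0"
    unfolding qpoch_inf_eq_0_iff using a1(2)[of "Suc _"] a by (auto simp: field_simps)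
  ultimately show ?thesis using nz'(4) by (simp add: field_simps)
qed

theorem bailey_6psi6:
  assumes ok: "wp4_ok a b c d e" and conv: "norm (a^2 * q / (b * c * d * e)) < 1"
  shows "psi a b c d e =
    (1 - a) * qpoch_inf q q * qpoch_inf q (a * q) * qpoch_inf q (q / a) * bailey_quotient a b c d e"
  using psi_eq_bailey_quotient_theta[OF ok conv] infsum_theta_term wp4_okD(1)[OF ok] by simp

section \<open>Reduction to Bailey's formula\<close>

lemma wp_okI:
  assumes "b \<noteq> 0" "\<And>j::nat. j \<ge> 1 \<Longrightarrow> b * q powi (- int j) \<noteq> 1" "\<And>j::nat. (a * q / b) * q ^ j \<noteq> 1"
  shows "wp_ok a b"
  unfolding wp_ok_def
proof (intro conjI allI impI)
  fix j :: nat assume "j > 0"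
  then obtain i where i: "j = Suc i" using gr0_implies_Suc by blast
  show "b \<noteq> q ^ j" using assms(2)[of j] \<open>j > 0\<close> q0 by (auto simp: power_int_minus)
  show "b \<noteq> a * q ^ j" using assms(1) assms(3)[of i] by (auto simp: i field_simps)
qed (rule assms(1))

end

theorem theorem4p3:
  fixes q a b c d e u :: complex
  assumes q: "0 < norm q" "norm q < 1"
    and nonzero: "a \<noteq> 0" "b \<noteq> 0" "c \<noteq> 0" "d \<noteq> 0" "e \<noteq> 0" "u \<noteq> 0"
    and a: "a \<noteq> 1"
    and bc: "a / (b * c) \<noteq> 1"
    and d: "\<And>n::int. d * q powi n \<noteq> 1"
    and e: "\<And>n::int. e * q powi n \<noteq> 1"
    and b_neg: "\<And>j::nat. j \<ge> 1 \<Longrightarrow> b * q powi (- int j) \<noteq> 1"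
    and c_neg: "\<And>j::nat. j \<ge> 1 \<Longrightarrow> c * q powi (- int j) \<noteq> 1"
    and aqb: "\<And>j::nat. (a * q / b) * q ^ j \<noteq> 1"
    and aqc: "\<And>j::nat. (a * q / c) * q ^ j \<noteq> 1"
    and aqd: "\<And>j::nat. (a * q / d) * q ^ j \<noteq> 1"
    and aqe: "\<And>j::nat. (a * q / e) * q ^ j \<noteq> 1"
    and conv: "norm (a\<^sup>2 / (b * c * d * e)) < 1"
  shows "((\<lambda>n::int.
            (1 - a * q powi (2 * n)) / (1 - a)
            * (qpochs q [b, c] n / qpochs q [a * q / b, a * q / c] n)
            * (qpochs q [d * q, e * q] n / qpochs q [a * q / d, a * q / e] n)
            * (a\<^sup>2 / (b * c * d * e)) powi n
            * (1 - ((1 - d * e / a) * (1 - u * q powi n) * (1 - a\<^sup>2 * q powi n / (b * c * u)))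
                   / ((1 - a / (b * c)) * (1 - d * q powi n) * (1 - e * q powi n))))
          has_sum
            ((1 - a / (c * u)) * (1 - b * u / a)
             * qpochs_inf q [q, a * q, q / a, a * q / (b * c), a * q / (b * d), a * q / (b * e),
                             a * q / (c * d), a * q / (c * e), a / (d * e)])
            / ((b - a / c)
             * qpochs_inf q [q / b, a * q / b, q / c, a * q / c, 1 / d, a * q / d, 1 / e, a * q / e,
                             a\<^sup>2 * q / (b * c * d * e)]))
         UNIV"
    (is "(?f has_sum ?S) UNIV")
proof -
  interpret q_disc q by standard (use q in auto)
  have ok: "wp4_ok a b c d e"
    unfolding wp4_ok_def using nonzero b_neg c_neg d e aqb aqc aqd aqe by (intro conjI wp_okI) auto
  have d1: "d \<noteq> 1" "e \<noteq> 1" using d[of 0] e[of 0] by auto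
  have bca: "b * c \<noteq> a" using bc nonzero by auto
  have A: "b * c * d * e \<noteq> a^2" using conv nonzero by auto
  define X where "X = (1 - d * e / a) / (1 - a / (b * c))"
  define \<beta> where "\<beta> = X * (u + a^2 / (b * c * u)) - (d + e)"
  define r where "r = 1 / ((1 - a) * (1 - d) * (1 - e))"
  define Q where "Q = (\<beta> - (1 - X) * ((b * c * d + b * c * e + b * d * e + c * d * e) / a - (b + c + d + e))
      / (1 - b * c * d * e / a^2))"
  \<comment> \<open>The identity behind the quasi-palindromic shape: the coefficient of \<open>x\<^sup>2\<close> is \<open>a\<close> times the constant one.\<close>
  have X': "(1 - X) * a = d * e - X * (a^2 / (b * c))"
  proof -
    have "X * (1 - a / (b * c)) = 1 - d * e / a" using bc by (simp add: X_def)
    then have "X - X * (a / (b * c)) = 1 - d * e / a" by (simp add: right_diff_distrib)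
    then have "a * (X - X * (a / (b * c))) = a * (1 - d * e / a)" by simp
    then show ?thesis using nonzero by (simp add: algebra_simps power2_eq_square)
  qed
  have summand: "?f n = r * ((1 - a * (q powi n)^2) * (a^2) powi n * wp4 a b c d e n
              * ((1 - X) * (1 + a * (q powi n)^2) + \<beta> * q powi n))" for n
  proof -
    define x where "x = q powi n"
    have dx: "1 - d * x \<noteq> 0" "1 - e * x \<noteq> 0" using d[of n] e[of n] by (auto simp: x_def)
    have "q powi (2 * n) = x^2"
      unfolding x_def power2_eq_square mult_2 using q0 by (subst power_int_add) auto
    moreover have "qpochs q [b, c] n / qpochs q [a * q / b, a * q / c] n = wp a b n * b powi n * (wp a c n * c powi n)"
      using nonzero by (simp add: qpochs_def wp_def)
    moreover have "qpochs q [d * q, e * q] n / qpochs q [a * q / d, a * q / e] n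
        = wp a d n * d powi n * (wp a e n * e powi n) * ((1 - d * x) * (1 - e * x)) / ((1 - d) * (1 - e))"
      using nonzero qpoch_shift[OF d] qpoch_shift[OF e] by (simp add: qpochs_def wp_def x_def mult_ac)
    moreover have "(a^2 / (b * c * d * e)) powi n = (a^2) powi n / (b powi n * c powi n * d powi n * e powi n)"
      by (simp add: power_int_divide_distrib power_int_mult_distrib)
    moreover have "1 - ((1 - d * e / a) * (1 - u * x) * (1 - a^2 * x / (b * c * u)))
                   / ((1 - a / (b * c)) * (1 - d * x) * (1 - e * x))
        = ((1 - X) * (1 + a * x^2) + \<beta> * x) / ((1 - d * x) * (1 - e * x))"
    proof -
      have "((1 - d * e / a) * (1 - u * x) * (1 - a^2 * x / (b * c * u))) / ((1 - a / (b * c)) * (1 - d * x) * (1 - e * x))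
         = X * ((1 - u * x) * (1 - a^2 * x / (b * c * u))) / ((1 - d * x) * (1 - e * x))"
        by (simp add: X_def mult_ac)
      also have "(1 - u * x) * (1 - a^2 * x / (b * c * u)) = 1 - (u + a^2 / (b * c * u)) * x + a^2 / (b * c) * x^2"
        using nonzero by (simp add: field_simps power2_eq_square)
      also have "1 - X * (1 - (u + a^2 / (b * c * u)) * x + a^2 / (b * c) * x^2) / ((1 - d * x) * (1 - e * x))
         = ((1 - d * x) * (1 - e * x) - X * (1 - (u + a^2 / (b * c * u)) * x + a^2 / (b * c) * x^2)) / ((1 - d * x) * (1 - e * x))"
        using dx by (simp add: diff_divide_distrib)
      also have "(1 - d * x) * (1 - e * x) - X * (1 - (u + a^2 / (b * c * u)) * x + a^2 / (b * c) * x^2)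
         = (1 - X) + \<beta> * x + (d * e - X * (a^2 / (b * c))) * x^2"
        by (simp add: \<beta>_def algebra_simps power2_eq_square)
      also have "\<dots> = (1 - X) * (1 + a * x^2) + \<beta> * x" unfolding X'[symmetric] by (simp add: algebra_simps)
      finally show ?thesis .
    qed
    ultimately show ?thesis
      unfolding x_def[symmetric] wp4_def r_def using nonzero dx by (simp add: mult_ac)
  qed
  have "(?f has_sum r * (Q * psi a b c d e)) UNIV"
    unfolding summand Q_def by (intro has_sum_cmult_right palindromic_has_sum ok conv)
  moreover have "r * (Q * psi a b c d e) = ?S"
  proof -
    have "norm (a^2 * q / (b * c * d * e)) < 1" using norm_mult_q_power_less[OF conv, of 1] by simp
    note psi = bailey_6psi6[OF ok this]
    have Q: "Q = (1 - a / (c * u)) * (1 - b * u / a) * (1 - a / (d * e)) * d * e / (b - a / c)"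
      unfolding Q_def \<beta>_def X_def by (rule reduction_constant[OF nonzero bca A])
    have i: "qpoch_inf q (a / (d * e)) = (1 - a / (d * e)) * qpoch_inf q (a * q / (d * e))"
      "qpoch_inf q (1 / d) = (1 - 1 / d) * qpoch_inf q (q / d)"
      "qpoch_inf q (1 / e) = (1 - 1 / e) * qpoch_inf q (q / e)"
      using qpoch_inf_rec[of "a / (d * e)"] qpoch_inf_rec[of "1 / d"] qpoch_inf_rec[of "1 / e"] by simp_all
    have j: "d * e / ((1 - d) * (1 - e)) = 1 / ((1 - 1 / d) * (1 - 1 / e))"
    proof -
      have "1 - d = - d * (1 - 1 / d)" "1 - e = - e * (1 - 1 / e)" using nonzero by (simp_all add: field_simps)
      then have "(1 - d) * (1 - e) = d * e * ((1 - 1 / d) * (1 - 1 / e))" by (simp add: mult_ac)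
      then show ?thesis using nonzero by simp
    qed
    define F where "F = qpoch_inf q q * qpoch_inf q (a * q) * qpoch_inf q (q / a) * bailey_quotient a b c d e"
    have "r * (1 - a) = 1 / ((1 - d) * (1 - e))" using a by (simp add: r_def)
    moreover have "r * (Q * psi a b c d e) = r * (1 - a) * Q * F"
      unfolding psi F_def by (simp only: mult_ac)
    ultimately have "r * (Q * psi a b c d e) = 1 / ((1 - d) * (1 - e)) * Q * F" by simp
    also have "\<dots> = d * e / ((1 - d) * (1 - e))
        * ((1 - a / (c * u)) * (1 - b * u / a) * (1 - a / (d * e)) / (b - a / c)) * F"
      unfolding Q by (simp add: mult_ac)
    also have "\<dots> = ?S"
      unfolding j F_def bailey_quotient_def qpochs_inf_def list.map prod_list.Cons prod_list.Nil i
      by (simp only: times_divide_times_eq divide_divide_eq_left mult_ac mult_1_left mult_1_right times_divide_eq_left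
          times_divide_eq_right)
    finally show ?thesis .
  qed
  ultimately show ?thesis by simp
qed

end
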